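(* Let $N,m\ge 1$. For $i=1,\dots,m$, let $\phi_i\in L^\infty_{loc}(\mathbf{R}^N)$ be such that $\phi_i^2>0$ a.e., and let $\sigma_i\in H^1_{loc}(\mathbf{R}^N)$. Assume that there is a constant $C$ such that $$\sum_{i=1}^m\int_{B_{2R}\setminus B_R}\phi_i^2\sigma_i^2\le C R^2\qquad\text{for all }R>1.$$ Suppose that $(\sigma_i)_{i=1}^m$ is a solution of $$\mathrm{div}(\phi_i^2\nabla\sigma_i)+\sum_{j=1}^m h_{i,j}(x)f(\sigma_i-\sigma_j)+k_i(x)g(\sigma_i)=0\quad\text{in }\mathbf{R}^N,\qquad i=1,\dots,m,$$ where $h_{i,j},k_i\in L^1_{loc}(\mathbf{R}^N)$ satisfy $h_{i,j}\le 0$, $k_i\le 0$ and $h_{i,j}=h_{j,i}$, and $f,g\in L^1_{loc}(\mathbf{R})$ are odd functions such that $f(t),g(t)\ge 0$ for $t\in\mathbf{R}^+$. Then, for all $i=1,\dots,m$, the function $\sigma_i$ is constant.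
   Context: $B_R$ denotes the open ball of radius $R$ centered at the origin of $\mathbf{R}^N$. Solutions are understood in the weak (distributional) sense, the terms $h_{i,j}f(\sigma_i-\sigma_j)$ and $k_i g(\sigma_i)$ being locally integrable; $f$ and $g$ are everywhere-defined functions on $\mathbf{R}$, odd in the pointwise sense. *)

theory Defs
  imports "HOL-Analysis.Analysis"
begin

primrec times_cont_diff :: "nat \<Rightarrow> ('a::euclidean_space \<Rightarrow> real) \<Rightarrow> bool" where
  "times_cont_diff 0 \<psi> \<longleftrightarrow> continuous_on UNIV \<psi>"
| "times_cont_diff (Suc n) \<psi> \<longleftrightarrow>
     (\<forall>x. \<psi> differentiable (at x)) \<and>
     (\<forall>v. times_cont_diff n (\<lambda>x. frechet_derivative \<psi> (at x) v))"

text \<open>The space of smooth functions with compact support.\<close>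

definition test_functions :: "('a::euclidean_space \<Rightarrow> real) set" where
  "test_functions = {\<psi>. (\<forall>n. times_cont_diff n \<psi>) \<and> compact (closure {x. \<psi> x \<noteq> 0})}"

definition grad :: "('a::euclidean_space \<Rightarrow> real) \<Rightarrow> 'a \<Rightarrow> 'a" where
  "grad \<psi> x = (\<Sum>b\<in>Basis. frechet_derivative \<psi> (at x) b *\<^sub>R b)"

text \<open>The local Lebesgue and Sobolev spaces are sets of functions, not of equivalence classes;
  their members are determined only up to null sets.\<close>

definition L1_loc :: "('a::euclidean_space \<Rightarrow> 'b::euclidean_space) set" where
  "L1_loc = {u. \<forall>K. compact K \<longrightarrow> set_integrable lebesgue K u}"

definition L2_loc :: "('a::euclidean_space \<Rightarrow> 'b::euclidean_space) set" where
  "L2_loc = {u \<in> borel_measurable lebesgue.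
     \<forall>K. compact K \<longrightarrow> set_integrable lebesgue K (\<lambda>x. (norm (u x))\<^sup>2)}"

definition Linf_loc :: "('a::euclidean_space \<Rightarrow> 'b::euclidean_space) set" where
  "Linf_loc = {u \<in> borel_measurable lebesgue.
     \<forall>K. compact K \<longrightarrow> (\<exists>M. AE x in lebesgue. x \<in> K \<longrightarrow> norm (u x) \<le> M)}"

definition has_weak_gradient ::
    "('a::euclidean_space \<Rightarrow> real) \<Rightarrow> ('a \<Rightarrow> 'a) \<Rightarrow> bool" where
  "has_weak_gradient u G \<longleftrightarrow> u \<in> L1_loc \<and> G \<in> L1_loc \<and>
     (\<forall>\<psi>\<in>test_functions.
        (LINT x|lebesgue. u x *\<^sub>R grad \<psi> x) = - (LINT x|lebesgue. \<psi> x *\<^sub>R G x))"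

definition H1_loc :: "('a::euclidean_space \<Rightarrow> real) set" where
  "H1_loc = {u \<in> L2_loc. \<exists>G\<in>L2_loc. has_weak_gradient u G}"

text \<open>The weak gradient of a member of \<open>H1_loc\<close>; it is unique up to null sets, so the choice
  of a representative is immaterial under an integral.\<close>

definition weak_grad :: "('a::euclidean_space \<Rightarrow> real) \<Rightarrow> 'a \<Rightarrow> 'a" where
  "weak_grad u = (SOME G. G \<in> L2_loc \<and> has_weak_gradient u G)"

text \<open>Weak solutions of the system
  \<open>div (\<phi>\<^sub>i\<^sup>2 \<nabla>\<sigma>\<^sub>i) + (\<Sum>j. h\<^sub>i\<^sub>j f (\<sigma>\<^sub>i - \<sigma>\<^sub>j)) + k\<^sub>i g \<sigma>\<^sub>i = 0\<close> for \<open>i = 1, \<dots>, m\<close>. Every zero-order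
  term has to be locally integrable. The flux \<open>\<phi>\<^sub>i\<^sup>2 \<nabla>\<sigma>\<^sub>i\<close> is locally integrable for
  \<open>\<phi>\<^sub>i\<close> in \<open>Linf_loc\<close> and \<open>\<sigma>\<^sub>i\<close> in \<open>H1_loc\<close>, the only case in which the definition is used.\<close>

definition weak_solution ::
    "nat \<Rightarrow> (nat \<Rightarrow> 'a::euclidean_space \<Rightarrow> real) \<Rightarrow> (nat \<Rightarrow> nat \<Rightarrow> 'a \<Rightarrow> real) \<Rightarrow>
     (nat \<Rightarrow> 'a \<Rightarrow> real) \<Rightarrow> (real \<Rightarrow> real) \<Rightarrow> (real \<Rightarrow> real) \<Rightarrow> (nat \<Rightarrow> 'a \<Rightarrow> real) \<Rightarrow> bool" where
  "weak_solution m \<phi> h k f g \<sigma> \<longleftrightarrow>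
     (\<forall>i\<in>{1..m}.
        (\<forall>j\<in>{1..m}. (\<lambda>x. h i j x * f (\<sigma> i x - \<sigma> j x)) \<in> L1_loc) \<and>
        (\<lambda>x. k i x * g (\<sigma> i x)) \<in> L1_loc \<and>
        (\<forall>\<psi>\<in>test_functions.
           - (LINT x|lebesgue. (\<phi> i x)\<^sup>2 * (weak_grad (\<sigma> i) x \<bullet> grad \<psi> x))
           + (LINT x|lebesgue.
                ((\<Sum>j\<in>{1..m}. h i j x * f (\<sigma> i x - \<sigma> j x)) + k i x * g (\<sigma> i x)) * \<psi> x) = 0))"

end

theory Submission
  imports Defs
begin

text \<open>
  The formal argument is to multiply the \<open>i\<close>-th equation by \<open>\<sigma>\<^sub>i \<zeta>\<^sup>2\<close>, with \<open>\<zeta>\<close> a cutoff at scale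
  \<open>R\<close>, and to sum over \<open>i\<close>. By the symmetry of \<open>h\<close> and the oddness of \<open>f\<close> the coupling terms combine
  to \<open>h\<^sub>i\<^sub>j f (\<sigma>\<^sub>i - \<sigma>\<^sub>j) (\<sigma>\<^sub>i - \<sigma>\<^sub>j) / 2 \<le> 0\<close>, and \<open>k\<^sub>i g (\<sigma>\<^sub>i) \<sigma>\<^sub>i \<le> 0\<close> as well, so that
  \<open>J (R) := \<Sum>\<^sub>i \<integral> \<phi>\<^sub>i\<^sup>2 \<bar>\<nabla>\<sigma>\<^sub>i\<bar>\<^sup>2 \<zeta>\<^sup>2 \<le> - 2 \<Sum>\<^sub>i \<integral> \<phi>\<^sub>i\<^sup>2 \<sigma>\<^sub>i \<zeta> \<nabla>\<sigma>\<^sub>i \<bullet> \<nabla>\<zeta>\<close>. The right-hand side lives on the annulus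
  between \<open>R\<close> and \<open>2 R\<close>, where \<open>\<bar>\<nabla>\<zeta>\<bar> \<le> D / R\<close>. Young's inequality with a parameter \<open>\<delta>\<close> and the
  growth hypothesis bound it by \<open>\<delta>\<close> times the energy of the annulus plus \<open>D\<^sup>2 C / \<delta>\<close>. Taking
  \<open>\<delta> = 1/2\<close> shows that the total energy is finite, hence that dyadic annuli carry energy tending
  to 0; letting \<open>R\<close> and then \<open>\<delta>\<close> tend to infinity shows that it is 0 (\<open>energy_vanishes\<close>). As
  \<open>\<phi>\<^sub>i\<^sup>2 > 0\<close>, the gradients vanish and the \<open>\<sigma>\<^sub>i\<close> are constant (\<open>weak_gradient_zero_imp_const\<close>).

  The function \<open>\<sigma>\<^sub>i \<zeta>\<^sup>2\<close> is not a test function: it is not smooth, and it is unbounded while the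
  zero-order terms are only locally integrable. Both defects are removed by using
  \<open>T (\<sigma>\<^sub>i\<^sub>,\<^sub>n) \<zeta>\<^sup>2\<close>, where \<open>\<sigma>\<^sub>i\<^sub>,\<^sub>n\<close> is a mollification of \<open>\<sigma>\<^sub>i\<close> and \<open>T s = k arctan (s / k)\<close> a smooth,
  bounded, odd and increasing substitute for truncation at height \<open>k\<close>. One lets \<open>n\<close> tend to
  infinity first (\<open>test_with_bounded_function\<close>); since \<open>T\<close> is odd and increasing, the zero-order
  terms still have a sign (\<open>coupling_sum_nonpos\<close>), and after discarding them one lets \<open>k\<close> tend to
  infinity (\<open>energy_inequality\<close>).

  This rests on the standard facts about mollification: convolution with a test function is smooth
  and commutes with weak gradients (\<open>smooth_conv\<close>, \<open>grad_conv\<close>), and mollified functions converge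
  in \<open>L\<^sup>2\<close> on balls (\<open>conv_tendsto_L2\<close>), by contractivity and the density of continuous functions.
\<close>


section \<open>Smooth functions\<close>

abbreviation smooth :: "('a::euclidean_space \<Rightarrow> real) \<Rightarrow> bool" where
  "smooth \<psi> \<equiv> \<forall>n. times_cont_diff n \<psi>"

lemma times_cont_diff_SucI:
  assumes "\<And>x. (\<psi> has_derivative \<psi>' x) (at x)"
    and "\<And>v. times_cont_diff n (\<lambda>x. \<psi>' x v)"
  shows "times_cont_diff (Suc n) \<psi>"
proof -
  have "frechet_derivative \<psi> (at x) = \<psi>' x" for x
    using frechet_derivative_at[OF assms(1)] by simp
  then show ?thesis
    using assms by (auto simp: differentiable_def)
qed

lemma times_cont_diff_SucD:
  assumes "times_cont_diff (Suc n) \<psi>"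
  shows "(\<psi> has_derivative frechet_derivative \<psi> (at x)) (at x)"
    and "times_cont_diff n (\<lambda>x. frechet_derivative \<psi> (at x) v)"
  using assms by (auto simp: frechet_derivative_works)

lemma times_cont_diff_Suc_imp:
  "times_cont_diff (Suc n) \<psi> \<Longrightarrow> times_cont_diff n \<psi>"
proof (induction n arbitrary: \<psi>)
  case 0
  then show ?case
    by (auto intro!: continuous_at_imp_continuous_on differentiable_imp_continuous_within)
next
  case (Suc n)
  from Suc.prems have "\<forall>x. \<psi> differentiable at x"
    and "times_cont_diff (Suc n) (\<lambda>x. frechet_derivative \<psi> (at x) v)" for v
    by auto
  then show ?case
    using Suc.IH by auto
qed

lemma times_cont_diff_const: "times_cont_diff n (\<lambda>x. c)"
proof (induction n arbitrary: c)
  case (Suc n)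
  show ?case
    by (rule times_cont_diff_SucI[where \<psi>'="\<lambda>x v. 0"]) (auto intro: Suc.IH)
qed auto

lemma times_cont_diff_inner: "times_cont_diff n (\<lambda>x. x \<bullet> a)"
proof (cases n)
  case (Suc k)
  show ?thesis
    unfolding Suc
    by (rule times_cont_diff_SucI[where \<psi>'="\<lambda>x v. v \<bullet> a"])
      (auto intro!: derivative_eq_intros times_cont_diff_const)
qed (auto intro!: continuous_intros)

lemma times_cont_diff_add:
  "times_cont_diff n \<psi> \<Longrightarrow> times_cont_diff n \<eta> \<Longrightarrow> times_cont_diff n (\<lambda>x. \<psi> x + \<eta> x)"
proof (induction n arbitrary: \<psi> \<eta>)
  case (Suc n)
  show ?case
    by (rule times_cont_diff_SucI
        [where \<psi>'="\<lambda>x v. frechet_derivative \<psi> (at x) v + frechet_derivative \<eta> (at x) v"])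
      (auto intro!: has_derivative_add Suc.IH times_cont_diff_SucD[OF Suc.prems(1)]
        times_cont_diff_SucD[OF Suc.prems(2)])
qed (auto intro!: continuous_intros)

lemma times_cont_diff_mult:
  "times_cont_diff n \<psi> \<Longrightarrow> times_cont_diff n \<eta> \<Longrightarrow> times_cont_diff n (\<lambda>x. \<psi> x * \<eta> x)"
proof (induction n arbitrary: \<psi> \<eta>)
  case (Suc n)
  note \<psi> = Suc.prems(1) and \<eta> = Suc.prems(2)
  show ?case
  proof (rule times_cont_diff_SucI)
    show "((\<lambda>x. \<psi> x * \<eta> x) has_derivative
        (\<lambda>v. \<psi> x * frechet_derivative \<eta> (at x) v + frechet_derivative \<psi> (at x) v * \<eta> x)) (at x)" for x
      by (intro has_derivative_mult times_cont_diff_SucD(1)[OF \<psi>] times_cont_diff_SucD(1)[OF \<eta>])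
    show "times_cont_diff n
        (\<lambda>x. \<psi> x * frechet_derivative \<eta> (at x) v + frechet_derivative \<psi> (at x) v * \<eta> x)" for v
      by (intro times_cont_diff_add Suc.IH times_cont_diff_SucD(2)[OF \<psi>]
          times_cont_diff_SucD(2)[OF \<eta>] times_cont_diff_Suc_imp[OF \<psi>] times_cont_diff_Suc_imp[OF \<eta>])
  qed
qed (auto intro!: continuous_intros)

lemma times_cont_diff_sum:
  "finite I \<Longrightarrow> (\<And>i. i \<in> I \<Longrightarrow> times_cont_diff n (\<psi> i)) \<Longrightarrow> times_cont_diff n (\<lambda>x. \<Sum>i\<in>I. \<psi> i x)"
  by (induction I rule: finite_induct) (auto intro: times_cont_diff_const times_cont_diff_add)

lemma times_cont_diff_diff:
  "times_cont_diff n \<psi> \<Longrightarrow> times_cont_diff n \<eta> \<Longrightarrow> times_cont_diff n (\<lambda>x. \<psi> x - \<eta> x)"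
  using times_cont_diff_add[of n \<psi> "\<lambda>x. - 1 * \<eta> x"]
    times_cont_diff_mult[OF times_cont_diff_const[of n "- 1"], of \<eta>] by simp

lemma times_cont_diff_inverse:
  "times_cont_diff n \<psi> \<Longrightarrow> (\<And>x. \<psi> x \<noteq> 0) \<Longrightarrow> times_cont_diff n (\<lambda>x. inverse (\<psi> x))"
proof (induction n arbitrary: \<psi>)
  case (Suc n)
  have *: "times_cont_diff n (\<lambda>x. inverse (\<psi> x))"
    by (rule Suc.IH[OF times_cont_diff_Suc_imp[OF Suc.prems(1)] Suc.prems(2)])
  show ?case
  proof (rule times_cont_diff_SucI)
    show "((\<lambda>x. inverse (\<psi> x)) has_derivative
        (\<lambda>v. - (inverse (\<psi> x) * frechet_derivative \<psi> (at x) v * inverse (\<psi> x)))) (at x)" for x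
      by (rule Deriv.has_derivative_inverse[OF Suc.prems(2) times_cont_diff_SucD(1)[OF Suc.prems(1)]])
    show "times_cont_diff n (\<lambda>x. - (inverse (\<psi> x) * frechet_derivative \<psi> (at x) v * inverse (\<psi> x)))" for v
      using times_cont_diff_diff[OF times_cont_diff_const[of n 0] times_cont_diff_mult[OF
          times_cont_diff_mult[OF * times_cont_diff_SucD(2)[OF Suc.prems(1), of v]] *]]
      by simp
  qed
qed (auto intro!: continuous_intros)

lemma times_cont_diff_compose:
  fixes T :: "real \<Rightarrow> real"
  shows "times_cont_diff n T \<Longrightarrow> times_cont_diff n \<psi> \<Longrightarrow> times_cont_diff n (\<lambda>x. T (\<psi> x))"
proof (induction n arbitrary: T \<psi>)
  case 0
  then show ?case
    by (auto intro: continuous_on_compose2[of UNIV T])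
next
  case (Suc n)
  have lin: "frechet_derivative T (at s) v = frechet_derivative T (at s) 1 * v" for s v
    using linear_scale[OF has_derivative_linear[OF times_cont_diff_SucD(1)[OF Suc.prems(1), of s]], of v 1]
    by simp
  show ?case
  proof (rule times_cont_diff_SucI)
    show "((\<lambda>x. T (\<psi> x)) has_derivative
        (\<lambda>v. frechet_derivative T (at (\<psi> x)) 1 * frechet_derivative \<psi> (at x) v)) (at x)" for x
      using has_derivative_compose[OF times_cont_diff_SucD(1)[OF Suc.prems(2), of x]
          times_cont_diff_SucD(1)[OF Suc.prems(1), of "\<psi> x"]]
      by (subst (asm) lin) simp
    show "times_cont_diff n (\<lambda>x. frechet_derivative T (at (\<psi> x)) 1 * frechet_derivative \<psi> (at x) v)" for v
      by (rule times_cont_diff_mult[OF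
            Suc.IH[OF times_cont_diff_SucD(2)[OF Suc.prems(1)] times_cont_diff_Suc_imp[OF Suc.prems(2)]]
            times_cont_diff_SucD(2)[OF Suc.prems(2)]])
  qed
qed

lemma times_cont_diff_affine:
  "times_cont_diff n \<psi> \<Longrightarrow> times_cont_diff n (\<lambda>x. \<psi> (b + a *\<^sub>R x))"
proof (induction n arbitrary: \<psi>)
  case 0
  then show ?case
    by (auto intro!: continuous_on_compose2[of UNIV \<psi>] continuous_intros)
next
  case (Suc n)
  show ?case
  proof (rule times_cont_diff_SucI)
    show "((\<lambda>x. \<psi> (b + a *\<^sub>R x)) has_derivative
        (\<lambda>v. a * frechet_derivative \<psi> (at (b + a *\<^sub>R x)) v)) (at x)" for x
    proof -
      have "((\<lambda>x. \<psi> (b + a *\<^sub>R x)) has_derivative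
          (\<lambda>v. frechet_derivative \<psi> (at (b + a *\<^sub>R x)) (a *\<^sub>R v))) (at x)"
        by (rule has_derivative_compose[OF _ times_cont_diff_SucD(1)[OF Suc.prems(1)]])
          (auto intro!: derivative_eq_intros)
      then show ?thesis
        by (simp add: linear_scale[OF has_derivative_linear[OF times_cont_diff_SucD(1)[OF Suc.prems(1)]]])
    qed
    show "times_cont_diff n (\<lambda>x. a * frechet_derivative \<psi> (at (b + a *\<^sub>R x)) v)" for v
      by (rule times_cont_diff_mult[OF times_cont_diff_const
            Suc.IH[OF times_cont_diff_SucD(2)[OF Suc.prems(1)]]])
  qed
qed

lemma times_cont_diff_inner_self: "times_cont_diff n (\<lambda>x. x \<bullet> x)"
proof -
  have "(\<lambda>x::'a. x \<bullet> x) = (\<lambda>x. \<Sum>b\<in>Basis. (x \<bullet> b) * (x \<bullet> b))"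
    by (rule ext) (rule euclidean_inner)
  then show ?thesis
    by (simp add: times_cont_diff_sum times_cont_diff_mult times_cont_diff_inner)
qed

text \<open>The derivative of \<open>arctan\<close> is rational, so one derivative reduces the claim to the closure
  properties above.\<close>

lemma times_cont_diff_arctan:
  assumes "smooth \<psi>"
  shows "smooth (\<lambda>x. arctan (\<psi> x))"
proof
  fix n
  show "times_cont_diff n (\<lambda>x. arctan (\<psi> x))"
  proof (cases n)
    case 0
    then show ?thesis
      using assms[THEN spec[of _ 0]] by (auto intro!: continuous_intros)
  next
    case (Suc k)
    have "times_cont_diff (Suc k) \<psi>"
      using assms by blast
    note D = times_cont_diff_SucD[OF this]
    have nz: "1 + (\<psi> x)\<^sup>2 \<noteq> 0" for x
      by (metis add_pos_nonneg less_irrefl zero_le_power2 zero_less_one)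
    show ?thesis
      unfolding Suc
    proof (rule times_cont_diff_SucI)
      show "((\<lambda>x. arctan (\<psi> x)) has_derivative
          (\<lambda>v. inverse (1 + (\<psi> x)\<^sup>2) * frechet_derivative \<psi> (at x) v)) (at x)" for x
        using has_derivative_compose[OF D(1)[of x]
            DERIV_arctan[of "\<psi> x", unfolded has_field_derivative_def]] .
      show "times_cont_diff k (\<lambda>x. inverse (1 + (\<psi> x)\<^sup>2) * frechet_derivative \<psi> (at x) v)" for v
        unfolding power2_eq_square using nz[unfolded power2_eq_square]
        by (intro times_cont_diff_mult times_cont_diff_inverse times_cont_diff_add
            times_cont_diff_const D(2)) (auto simp: assms)
    qed
  qed
qed

text \<open>Cutoffs and mollifiers are built from the function \<open>exp (- 1 / s)\<close>, extended by 0 to \<open>s \<le> 0\<close>. All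
  its derivatives have the form \<open>p (1 / s) exp (- 1 / s)\<close> with a polynomial \<open>p\<close>. This family is closed
  under differentiation, also at the origin, and therefore consists of smooth functions.\<close>

definition flat :: "real poly \<Rightarrow> real \<Rightarrow> real" where
  "flat p s = (if s > 0 then poly p (inverse s) * exp (- inverse s) else 0)"

lemma tendsto_poly_times_exp_neg: "((\<lambda>t::real. poly p t * exp (- t)) \<longlongrightarrow> 0) at_top"
proof -
  have "((\<lambda>t. \<Sum>i\<le>degree p. coeff p i * (t ^ i / exp t)) \<longlongrightarrow> 0) at_top"
    by (rule tendsto_null_sum, rule tendsto_mult_right_zero, rule tendsto_power_div_exp_0)
  then show ?thesis
    by (simp add: poly_altdef exp_minus sum_distrib_right divide_inverse mult.assoc)
qed

lemma flat_tendsto_0: "(flat p \<longlongrightarrow> 0) (at 0)"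
proof -
  have "((\<lambda>s. poly p (inverse s) * exp (- inverse s)) \<longlongrightarrow> 0) (at_right 0)"
    using filterlim_compose[OF tendsto_poly_times_exp_neg filterlim_inverse_at_top_right] .
  then have r: "(flat p \<longlongrightarrow> 0) (at_right 0)"
    by (rule tendsto_cong[THEN iffD1, rotated]) (auto simp: eventually_at_filter flat_def)
  have l: "(flat p \<longlongrightarrow> 0) (at_left 0)"
    by (rule tendsto_cong[THEN iffD1, OF _ tendsto_const]) (auto simp: eventually_at_filter flat_def)
  show ?thesis
    using l r by (simp add: filterlim_split_at)
qed

lemma flat_has_derivative:
  "(flat p has_real_derivative flat (monom 1 2 * (p - pderiv p)) s) (at s)"
proof -
  consider "s > 0" | "s < 0" | "s = 0" by linarith
  then show ?thesis
  proof cases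
    case 1
    have "((\<lambda>s. poly p (inverse s) * exp (- inverse s)) has_real_derivative
        flat (monom 1 2 * (p - pderiv p)) s) (at s)"
      using 1 by (auto intro!: derivative_eq_intros simp: flat_def poly_monom power2_eq_square algebra_simps)
    then show ?thesis
      by (rule has_field_derivative_transform_within_open[of _ _ _ "{0<..}"])
        (use 1 in \<open>auto simp: flat_def\<close>)
  next
    case 2
    have "((\<lambda>s. 0) has_real_derivative flat (monom 1 2 * (p - pderiv p)) s) (at s)"
      using 2 by (simp add: flat_def)
    then show ?thesis
      by (rule has_field_derivative_transform_within_open[of _ _ _ "{..<0}"])
        (use 2 in \<open>auto simp: flat_def\<close>)
  next
    case 3
    have "flat p s / s = flat (pCons 0 p) s" and "flat q 0 = 0" for s q
      by (simp_all add: flat_def divide_inverse)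
    then show ?thesis
      using flat_tendsto_0[of "pCons 0 p"] unfolding 3 has_field_derivative_iff by simp
  qed
qed

lemma smooth_flat: "smooth (flat p)"
proof
  fix n
  show "times_cont_diff n (flat p)"
  proof (induction n arbitrary: p)
    case 0
    show ?case
      by (auto intro!: continuous_at_imp_continuous_on DERIV_isCont flat_has_derivative)
  next
    case (Suc n)
    show ?case
    proof (rule times_cont_diff_SucI)
      show "(flat p has_derivative (\<lambda>v. flat (monom 1 2 * (p - pderiv p)) s * v)) (at s)" for s
        using flat_has_derivative by (simp add: has_field_derivative_def)
      show "times_cont_diff n (\<lambda>s. flat (monom 1 2 * (p - pderiv p)) s * v)" for v
        by (intro times_cont_diff_mult times_cont_diff_const Suc.IH)
    qed
  qed
qed

lemma measurable_lebesgue_if_continuous: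
  fixes b :: "'a::euclidean_space \<Rightarrow> 'b::euclidean_space"
  assumes "continuous_on UNIV b"
  shows "b \<in> borel_measurable lebesgue"
  using assms by (intro measurable_completion) (simp add: borel_measurable_continuous_onI)

lemma smooth_imp_differentiable: "smooth \<psi> \<Longrightarrow> \<psi> differentiable at x"
  using times_cont_diff_SucD(1)[of 0 \<psi> x] by (auto simp: differentiable_def)

lemma grad_eqI:
  assumes "(\<psi> has_derivative (\<lambda>v. v \<bullet> g)) (at x)"
  shows "grad \<psi> x = g"
  unfolding grad_def frechet_derivative_at[OF assms, symmetric]
  by (subst (2) euclidean_representation[symmetric]) (simp add: inner_commute)

lemma differentiable_has_derivative_grad:
  assumes "\<psi> differentiable at x"
  shows "(\<psi> has_derivative (\<lambda>v. v \<bullet> grad \<psi> x)) (at x)"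
proof -
  have D: "(\<psi> has_derivative frechet_derivative \<psi> (at x)) (at x)"
    using assms by (simp add: frechet_derivative_works)
  have "frechet_derivative \<psi> (at x) v = v \<bullet> grad \<psi> x" for v
  proof -
    have "frechet_derivative \<psi> (at x) v = frechet_derivative \<psi> (at x) (\<Sum>b\<in>Basis. (v \<bullet> b) *\<^sub>R b)"
      by (simp add: euclidean_representation)
    also have "\<dots> = v \<bullet> grad \<psi> x"
      by (simp add: grad_def inner_sum_right linear_sum[OF has_derivative_linear[OF D]]
          linear_scale[OF has_derivative_linear[OF D]] mult.commute)
    finally show ?thesis .
  qed
  then show ?thesis
    using D by presburger
qed

lemmas smooth_has_derivative =
  differentiable_has_derivative_grad[OF smooth_imp_differentiable]

lemma smooth_continuous: "smooth \<psi> \<Longrightarrow> continuous_on UNIV \<psi>"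
  by (drule spec[of _ 0]) simp

lemma smooth_grad_inner:
  assumes "smooth \<psi>"
  shows "smooth (\<lambda>x. grad \<psi> x \<bullet> v)"
proof
  fix n
  have "frechet_derivative \<psi> (at x) v = grad \<psi> x \<bullet> v" for x
    using frechet_derivative_at[OF smooth_has_derivative[OF assms], of x, symmetric]
    by (simp add: inner_commute)
  then show "times_cont_diff n (\<lambda>x. grad \<psi> x \<bullet> v)"
    using times_cont_diff_SucD(2)[OF assms[rule_format, of "Suc n"], of v] by simp
qed

lemma smooth_continuous_grad: "smooth \<psi> \<Longrightarrow> continuous_on UNIV (grad \<psi>)"
  by (subst continuous_on_componentwise) (intro ballI smooth_continuous smooth_grad_inner)

lemma grad_eq_0_if_locally_const:
  assumes "open S" "x \<in> S" "\<And>y. y \<in> S \<Longrightarrow> \<psi> y = c"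
  shows "grad \<psi> x = 0"
proof (rule grad_eqI)
  have "((\<lambda>y. c) has_derivative (\<lambda>v. v \<bullet> 0)) (at x)"
    by auto
  then show "(\<psi> has_derivative (\<lambda>v. v \<bullet> 0)) (at x)"
    by (rule has_derivative_transform_within_open[OF _ assms(1,2)]) (simp add: assms(3))
qed

section \<open>Test functions, cutoffs and mollifiers\<close>

lemma test_functionI:
  assumes "smooth \<psi>" and "\<And>x. norm x > r \<Longrightarrow> \<psi> x = 0"
  shows "\<psi> \<in> test_functions"
proof -
  have "{x. \<psi> x \<noteq> 0} \<subseteq> cball 0 r"
    using assms(2) by (auto simp: not_less[symmetric])
  then have "bounded {x. \<psi> x \<noteq> 0}"
    using bounded_subset bounded_cball by blast
  then show ?thesis
    using assms(1) by (auto simp: test_functions_def)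
qed

lemma test_function_smooth: "\<psi> \<in> test_functions \<Longrightarrow> smooth \<psi>"
  by (simp add: test_functions_def)

lemma test_function_support:
  assumes "\<psi> \<in> test_functions"
  obtains r where "r > 0" "\<And>x. norm x > r \<Longrightarrow> \<psi> x = 0" "\<And>x. norm x > r \<Longrightarrow> grad \<psi> x = 0"
proof -
  have "bounded {x. \<psi> x \<noteq> 0}"
    using assms bounded_subset[OF compact_imp_bounded closure_subset]
    by (auto simp: test_functions_def)
  then obtain r where r: "r > 0" "\<And>x. \<psi> x \<noteq> 0 \<Longrightarrow> norm x \<le> r"
    unfolding bounded_pos by auto
  show thesis
  proof
    show "\<psi> x = 0" if "norm x > r" for x
      using r(2)[of x] that by auto
    then show "grad \<psi> x = 0" if "norm x > r" for x
      using that by (intro grad_eq_0_if_locally_const[of "- cball 0 r" x \<psi> 0]) auto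
  qed fact
qed

lemma test_function_mult:
  assumes "\<psi> \<in> test_functions" "smooth w"
  shows "(\<lambda>x. w x * \<psi> x) \<in> test_functions"
proof -
  obtain r where "\<And>x. norm x > r \<Longrightarrow> \<psi> x = 0"
    using test_function_support[OF assms(1)] by metis
  then show ?thesis
    using assms(2) test_function_smooth[OF assms(1)]
    by (intro test_functionI[of _ r]) (auto intro: times_cont_diff_mult)
qed

lemma test_function_affine:
  assumes "\<psi> \<in> test_functions" "a \<noteq> 0"
  shows "(\<lambda>x. \<psi> (b + a *\<^sub>R x)) \<in> test_functions"
proof -
  obtain r where r: "\<And>x. norm x > r \<Longrightarrow> \<psi> x = 0"
    using test_function_support[OF assms(1)] by metis
  show ?thesis
  proof (rule test_functionI)
    show "smooth (\<lambda>x. \<psi> (b + a *\<^sub>R x))"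
      using test_function_smooth[OF assms(1)] times_cont_diff_affine by blast
    show "\<psi> (b + a *\<^sub>R x) = 0" if "norm x > (r + norm b) / \<bar>a\<bar>" for x
    proof (rule r)
      have "r + norm b < \<bar>a\<bar> * norm x"
        using that assms(2) by (simp add: field_simps)
      also have "\<dots> \<le> norm (b + a *\<^sub>R x) + norm b"
        using norm_triangle_ineq4[of "b + a *\<^sub>R x" b] by simp
      finally show "r < norm (b + a *\<^sub>R x)" by simp
    qed
  qed
qed

lemma grad_affine:
  assumes "smooth \<psi>"
  shows "grad (\<lambda>x. \<psi> (b + a *\<^sub>R x)) x = a *\<^sub>R grad \<psi> (b + a *\<^sub>R x)"
proof (rule grad_eqI)
  have "((\<lambda>x. \<psi> (b + a *\<^sub>R x)) has_derivative (\<lambda>v. (a *\<^sub>R v) \<bullet> grad \<psi> (b + a *\<^sub>R x))) (at x)"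
    by (rule has_derivative_compose[OF _ smooth_has_derivative[OF assms]])
      (auto intro!: derivative_eq_intros)
  then show "((\<lambda>x. \<psi> (b + a *\<^sub>R x)) has_derivative (\<lambda>v. v \<bullet> a *\<^sub>R grad \<psi> (b + a *\<^sub>R x))) (at x)"
    by simp
qed

lemma grad_mult:
  assumes "smooth \<psi>" "smooth \<eta>"
  shows "grad (\<lambda>x. \<psi> x * \<eta> x) x = \<psi> x *\<^sub>R grad \<eta> x + \<eta> x *\<^sub>R grad \<psi> x"
  using has_derivative_mult[OF smooth_has_derivative[OF assms(1), of x] smooth_has_derivative[OF assms(2)]]
  by (intro grad_eqI) (simp add: inner_add_right mult.commute)

lemma test_function_grad_inner:
  assumes "\<psi> \<in> test_functions"
  shows "(\<lambda>x. grad \<psi> x \<bullet> v) \<in> test_functions"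
proof -
  obtain r where r: "\<And>x. norm x > r \<Longrightarrow> grad \<psi> x = 0"
    using test_function_support[OF assms] by metis
  show ?thesis
    by (rule test_functionI[OF smooth_grad_inner[OF test_function_smooth[OF assms]], of r]) (simp add: r)
qed

lemma test_function_grad_bounded:
  assumes "\<psi> \<in> test_functions"
  obtains L where "L > 0" "\<And>x. norm (grad \<psi> x) \<le> L"
proof -
  obtain r where r: "r > 0" "\<And>x. norm x > r \<Longrightarrow> grad \<psi> x = 0"
    using test_function_support[OF assms] by metis
  have "compact (grad \<psi> ` cball 0 r)"
    by (intro compact_continuous_image continuous_on_subset[OF smooth_continuous_grad]
        test_function_smooth assms) auto
  from compact_imp_bounded[OF this]
  obtain L where L: "L > 0" "\<And>x. x \<in> cball 0 r \<Longrightarrow> norm (grad \<psi> x) \<le> L"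
    unfolding bounded_pos by auto
  show thesis
  proof
    show "norm (grad \<psi> x) \<le> L" for x
      using L r(2)[of x] by (cases "norm x \<le> r") auto
  qed fact
qed

text \<open>The functions are rescalings of a single cutoff, which is 1 on the unit ball and 0 outside the
  ball of radius 2; this is where the factor \<open>1 / R\<close> comes from that compensates the growth \<open>R\<^sup>2\<close> of
  the weighted mass of the annuli.\<close>

lemma cutoff_functions:
  obtains D :: real and \<zeta> :: "real \<Rightarrow> 'a::euclidean_space \<Rightarrow> real"
  where "\<And>R. R > 0 \<Longrightarrow> \<zeta> R \<in> test_functions"
    and "\<And>R x. 0 \<le> \<zeta> R x \<and> \<zeta> R x \<le> 1"
    and "\<And>R x. R > 0 \<Longrightarrow> x \<in> ball 0 R \<Longrightarrow> \<zeta> R x = 1"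
    and "\<And>R x. R > 0 \<Longrightarrow> norm (grad (\<zeta> R) x) \<le> D / R"
    and "\<And>R x. R > 0 \<Longrightarrow> x \<notin> ball 0 (2 * R) - ball 0 R \<Longrightarrow> grad (\<zeta> R) x = 0"
proof -
  define e where "e = flat 1"
  have e_pos: "e s > 0" if "s > 0" for s
    using that by (simp add: e_def flat_def)
  have e_0: "e s = 0" if "s \<le> 0" for s
    using that by (simp add: e_def flat_def)
  have e_nonneg: "e s \<ge> 0" for s
    by (simp add: e_def flat_def)
  have smooth_e: "smooth e"
    unfolding e_def by (rule smooth_flat)
  define d where "d x = e (3 - x \<bullet> x) + e (x \<bullet> x - 1)" for x :: 'a
  define z where "z x = e (3 - x \<bullet> x) * inverse (d x)" for x :: 'a
  have d_pos: "d x > 0" for x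
    using e_pos[of "3 - x \<bullet> x"] e_pos[of "x \<bullet> x - 1"] e_nonneg[of "3 - x \<bullet> x"] e_nonneg[of "x \<bullet> x - 1"]
    unfolding d_def by linarith
  have s1: "times_cont_diff n (\<lambda>x::'a. e (3 - x \<bullet> x))" for n
    by (rule times_cont_diff_compose[OF smooth_e[rule_format]
          times_cont_diff_diff[OF times_cont_diff_const times_cont_diff_inner_self]])
  have s2: "times_cont_diff n (\<lambda>x::'a. e (x \<bullet> x - 1))" for n
    by (rule times_cont_diff_compose[OF smooth_e[rule_format]
          times_cont_diff_diff[OF times_cont_diff_inner_self times_cont_diff_const]])
  have "times_cont_diff n d" for n
    unfolding d_def by (rule times_cont_diff_add[OF s1 s2])
  then have "times_cont_diff n (\<lambda>x. inverse (d x))" for n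
    using d_pos by (rule times_cont_diff_inverse[OF _ less_imp_neq[symmetric]])
  then have smooth_z: "smooth z"
    unfolding z_def using times_cont_diff_mult[OF s1] by blast
  have sq: "x \<bullet> x = (norm x)\<^sup>2" for x :: 'a
    by (simp add: power2_norm_eq_inner)
  have z_1: "z x = 1" if "norm x \<le> 1" for x
  proof -
    have "x \<bullet> x \<le> 1"
      using that by (simp add: sq power_le_one)
    then show ?thesis
      using e_0[of "x \<bullet> x - 1"] d_pos[of x] by (simp add: z_def d_def)
  qed
  \<comment> \<open>The cutoff vanishes from \<open>sqrt 3\<close> on. A radius strictly below 2 makes it vanish in a neighbourhood
    of the complement of the ball of radius 2, so that its gradient is 0 there as well.\<close>
  have z_0: "z x = 0" if "norm x \<ge> 7 / 4" for x
  proof -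
    have "(7 / 4)\<^sup>2 \<le> x \<bullet> x"
      unfolding sq using that by (intro power_mono) auto
    then have "3 \<le> x \<bullet> x"
      by (simp add: power2_eq_square)
    then show ?thesis
      by (simp add: z_def e_0)
  qed
  have z_range: "0 \<le> z x \<and> z x \<le> 1" for x
    using d_pos[of x] e_nonneg[of "3 - x \<bullet> x"] e_nonneg[of "x \<bullet> x - 1"]
    by (simp add: z_def field_simps) (simp add: d_def)
  have test_z: "z \<in> test_functions"
    using z_0 by (intro test_functionI[OF smooth_z, of "7 / 4"]) auto
  obtain D where D: "\<And>x. norm (grad z x) \<le> D"
    using test_function_grad_bounded[OF test_z] by metis
  define \<zeta> where "\<zeta> R x = z (0 + inverse R *\<^sub>R x)" for R and x :: 'a
  show thesis
  proof
    show "\<zeta> R \<in> test_functions" if "R > 0" for R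
      unfolding \<zeta>_def using that by (intro test_function_affine test_z) auto
    show "0 \<le> \<zeta> R x \<and> \<zeta> R x \<le> 1" for R x
      unfolding \<zeta>_def by (rule z_range)
    show one: "\<zeta> R x = 1" if "R > 0" "x \<in> ball 0 R" for R x
      unfolding \<zeta>_def using that by (intro z_1) (simp add: field_simps)
    have zero: "\<zeta> R x = 0" if "R > 0" "norm x \<ge> 7 / 4 * R" for R x
      unfolding \<zeta>_def using that by (intro z_0) (simp add: field_simps)
    have g: "grad (\<zeta> R) x = inverse R *\<^sub>R grad z (0 + inverse R *\<^sub>R x)" for R x
      unfolding \<zeta>_def[abs_def] by (rule grad_affine[OF smooth_z])
    show "norm (grad (\<zeta> R) x) \<le> D / R" if "R > 0" for R x
      unfolding g using that D by (simp add: divide_inverse mult.commute)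
    show "grad (\<zeta> R) x = 0" if "R > 0" "x \<notin> ball 0 (2 * R) - ball 0 R" for R x
    proof (cases "norm x < R")
      case True
      then show ?thesis
        by (intro grad_eq_0_if_locally_const[of "ball 0 R" _ _ 1]) (auto simp: one that)
    next
      case False
      then show ?thesis
        using that by (intro grad_eq_0_if_locally_const[of "- cball 0 (7 / 4 * R)" _ _ 0])
          (auto intro!: zero)
    qed
  qed
qed

text \<open>The mass is measured by \<open>lborel\<close> rather than \<open>lebesgue\<close>, since the integrals over products below
  are exchanged in the Borel product.\<close>

definition is_mollifier :: "real \<Rightarrow> ('a::euclidean_space \<Rightarrow> real) \<Rightarrow> bool" where
  "is_mollifier \<delta> \<rho> \<longleftrightarrow> \<rho> \<in> test_functions \<and> (\<forall>x. \<rho> x \<ge> 0) \<and> (\<forall>x. norm x \<ge> \<delta> \<longrightarrow> \<rho> x = 0) \<and>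
     integrable lborel \<rho> \<and> (LINT x|lborel. \<rho> x) = 1"

lemma ex_mollifier:
  assumes "\<delta> > 0"
  shows "\<exists>\<rho> :: 'a::euclidean_space \<Rightarrow> real. is_mollifier \<delta> \<rho>"
proof -
  define b where "b x = flat 1 (\<delta>\<^sup>2 - x \<bullet> x)" for x :: 'a
  have pos: "b x > 0" if "norm x < \<delta>" for x
    using that power_strict_mono[OF that, of 2] by (simp add: b_def flat_def power2_norm_eq_inner)
  have nonneg: "b x \<ge> 0" for x
    by (simp add: b_def flat_def)
  have zero: "b x = 0" if "norm x \<ge> \<delta>" for x
  proof -
    have "\<delta>\<^sup>2 \<le> x \<bullet> x"
      using that assms power_mono[OF that, of 2] by (simp add: power2_norm_eq_inner)
    then show ?thesis
      by (simp add: b_def flat_def)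
  qed
  have smooth_b: "times_cont_diff n b" for n
    unfolding b_def by (rule times_cont_diff_compose[OF smooth_flat[rule_format]
          times_cont_diff_diff[OF times_cont_diff_const times_cont_diff_inner_self]])
  then have cont: "continuous_on UNIV b"
    by (simp add: smooth_continuous)
  have test: "b \<in> test_functions"
    using zero smooth_b by (intro test_functionI[of b \<delta>]) auto
  have "integrable lborel (\<lambda>x. indicator (cball 0 \<delta>) x *\<^sub>R b x)"
    by (rule borel_integrable_compact) (auto intro: continuous_on_subset[OF cont])
  also have "(\<lambda>x. indicator (cball 0 \<delta>) x *\<^sub>R b x) = b"
    using zero by (auto simp: indicator_def fun_eq_iff)
  finally have int: "integrable lborel b" .
  define c where "c = (LINT x|lborel. b x)"
  have "c \<noteq> 0"
  proof
    assume "c = 0"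
    then have "AE x in lborel. b x = 0"
      using integral_nonneg_eq_0_iff_AE[OF int] nonneg by (simp add: c_def)
    then have "AE x in lborel. x \<notin> ball (0::'a) \<delta>"
      by eventually_elim (use pos in fastforce)
    then have "ball (0::'a) \<delta> \<in> null_sets lborel"
      by (simp add: AE_iff_null_sets)
    then show False
      using assms open_not_negligible[of "ball (0::'a) \<delta>"]
      by (auto simp: negligible_iff_null_sets intro: null_sets_completionI)
  qed
  then have c: "c > 0"
    using Bochner_Integration.integral_nonneg[of lborel b] nonneg by (simp add: c_def less_le)
  have "(\<lambda>x. inverse c * b x) \<in> test_functions"
    by (intro test_function_mult test) (auto intro: times_cont_diff_const)
  then have "is_mollifier \<delta> (\<lambda>x. inverse c * b x)"
    using c nonneg zero int by (simp add: is_mollifier_def c_def[symmetric])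
  then show ?thesis by blast
qed

section \<open>Convolution with a test function\<close>

definition conv :: "('a::euclidean_space \<Rightarrow> real) \<Rightarrow> ('a \<Rightarrow> real) \<Rightarrow> 'a \<Rightarrow> real" where
  "conv u \<psi> x = (LINT y|lebesgue. u y * \<psi> (x - y))"

lemma L1_loc_integrable_cball:
  "u \<in> L1_loc \<Longrightarrow> integrable lebesgue (\<lambda>x. indicator (cball 0 r) x *\<^sub>R u x)"
  by (auto simp: L1_loc_def set_integrable_def)

lemma integrable_L1_loc_times_bounded:
  fixes u :: "'a::euclidean_space \<Rightarrow> real" and b :: "'a \<Rightarrow> 'b::euclidean_space"
  assumes u: "u \<in> L1_loc" and b[measurable]: "b \<in> borel_measurable lebesgue"
    and bound: "\<And>x. norm (b x) \<le> B" and zero: "\<And>x. norm x > r \<Longrightarrow> b x = 0"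
  shows "integrable lebesgue (\<lambda>x. u x *\<^sub>R b x)"
proof -
  note int = L1_loc_integrable_cball[OF u, of r]
  note [measurable] = borel_measurable_integrable[OF int]
  have eq: "u x *\<^sub>R b x = (indicator (cball 0 r) x *\<^sub>R u x) *\<^sub>R b x" for x
    using zero[of x] by (cases "norm x > r") (auto simp: indicator_def)
  show ?thesis
  proof (rule Bochner_Integration.integrable_bound[OF integrable_mult_right[OF int, of B]])
    show "(\<lambda>x. u x *\<^sub>R b x) \<in> borel_measurable lebesgue"
      unfolding eq by measurable
    show "AE x in lebesgue. norm (u x *\<^sub>R b x) \<le> norm (B * indicator (cball 0 r) x *\<^sub>R u x)"
    proof (rule AE_I2)
      fix x
      have "norm (u x *\<^sub>R b x) \<le> \<bar>indicator (cball 0 r) x *\<^sub>R u x\<bar> * B"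
        unfolding eq norm_scaleR by (intro mult_left_mono bound) auto
      also have "\<dots> \<le> norm (B * indicator (cball 0 r) x *\<^sub>R u x)"
        using order_trans[OF norm_ge_zero bound] by (simp add: abs_mult)
      finally show "norm (u x *\<^sub>R b x) \<le> norm (B * indicator (cball 0 r) x *\<^sub>R u x)" .
    qed
  qed
qed

lemma continuous_compact_support_bounded:
  fixes b :: "'a::euclidean_space \<Rightarrow> 'b::euclidean_space"
  assumes "continuous_on UNIV b" and zero: "\<And>x. norm x > r \<Longrightarrow> b x = 0"
  obtains B where "\<And>x. norm (b x) \<le> B"
proof -
  have "compact (b ` cball 0 r)"
    by (intro compact_continuous_image continuous_on_subset[OF assms(1)]) auto
  from compact_imp_bounded[OF this]
  obtain B where B: "B > 0" "\<And>x. x \<in> cball 0 r \<Longrightarrow> norm (b x) \<le> B"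
    unfolding bounded_pos by auto
  show thesis
    using B zero by (intro that[of B]) (metis less_imp_le mem_cball_0 not_le norm_zero)
qed

lemma integrable_L1_loc_times_continuous:
  fixes u :: "'a::euclidean_space \<Rightarrow> real" and b :: "'a \<Rightarrow> 'b::euclidean_space"
  assumes "u \<in> L1_loc" and "continuous_on UNIV b" and "\<And>x. norm x > r \<Longrightarrow> b x = 0"
  shows "integrable lebesgue (\<lambda>x. u x *\<^sub>R b x)"
proof -
  obtain B where "\<And>x. norm (b x) \<le> B"
    using continuous_compact_support_bounded[OF assms(2,3)] by metis
  then show ?thesis
    by (rule integrable_L1_loc_times_bounded[OF assms(1) measurable_lebesgue_if_continuous[OF assms(2)] _ assms(3)])
qed

lemma L1_loc_inner:
  fixes G :: "'a::euclidean_space \<Rightarrow> 'b::euclidean_space"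
  assumes "G \<in> L1_loc"
  shows "(\<lambda>x. G x \<bullet> v) \<in> L1_loc"
  unfolding L1_loc_def set_integrable_def
proof (intro CollectI allI impI)
  fix K :: "'a set"
  assume "compact K"
  then have "integrable lebesgue (\<lambda>x. indicator K x *\<^sub>R G x)"
    using assms by (simp add: L1_loc_def set_integrable_def)
  then have "integrable lebesgue (\<lambda>x. (indicator K x *\<^sub>R G x) \<bullet> v)"
    by (rule integrable_inner_left)
  then show "integrable lebesgue (\<lambda>x. indicator K x *\<^sub>R (G x \<bullet> v))"
    by simp
qed

lemma integrable_L1_loc_times_test:
  assumes "u \<in> L1_loc" "\<psi> \<in> test_functions"
  shows "integrable lebesgue (\<lambda>y. u y * \<psi> y)"
proof -
  obtain r where "\<And>x. norm x > r \<Longrightarrow> \<psi> x = 0"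
    using test_function_support[OF assms(2)] by metis
  then show ?thesis
    using integrable_L1_loc_times_continuous[OF assms(1)
        smooth_continuous[OF test_function_smooth[OF assms(2)]], of r] by simp
qed

lemma test_function_reflect:
  "\<psi> \<in> test_functions \<Longrightarrow> (\<lambda>y. \<psi> (x - y)) \<in> test_functions"
  using test_function_affine[of \<psi> "- 1" x] by simp

lemma integrable_conv:
  "u \<in> L1_loc \<Longrightarrow> \<psi> \<in> test_functions \<Longrightarrow> integrable lebesgue (\<lambda>y. u y * \<psi> (x - y))"
  by (intro integrable_L1_loc_times_test test_function_reflect)

text \<open>The difference quotients of \<open>\<psi>\<close> differ from the derivatives by at most twice the Lipschitz
  constant, and both vanish outside a fixed ball, on which \<open>u\<close> is integrable; so one may differentiate
  under the integral sign, by dominated convergence along sequences.\<close>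

lemma conv_has_derivative:
  assumes u: "u \<in> L1_loc" and \<psi>: "\<psi> \<in> test_functions"
  shows "(conv u \<psi> has_derivative (\<lambda>v. conv u (\<lambda>z. grad \<psi> z \<bullet> v) x)) (at x)"
  unfolding has_derivative_iff_norm
proof
  note sm = test_function_smooth[OF \<psi>]
  have int: "integrable lebesgue (\<lambda>y. u y * (grad \<psi> (x - y) \<bullet> v))" for v x
    by (rule integrable_conv[OF u test_function_grad_inner[OF \<psi>]])
  have "linear (\<lambda>v. conv u (\<lambda>z. grad \<psi> z \<bullet> v) x)"
    unfolding conv_def
    by (rule linearI) (use int in \<open>simp_all add: inner_add_right distrib_left mult.left_commute\<close>)
  then show "bounded_linear (\<lambda>v. conv u (\<lambda>z. grad \<psi> z \<bullet> v) x)"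
    by (rule linear_conv_bounded_linear[THEN iffD1])
  obtain r where r: "\<And>x. norm x > r \<Longrightarrow> \<psi> x = 0" "\<And>x. norm x > r \<Longrightarrow> grad \<psi> x = 0"
    using test_function_support[OF \<psi>] by metis
  obtain L where L: "L > 0" "\<And>x. norm (grad \<psi> x) \<le> L"
    using test_function_grad_bounded[OF \<psi>] by metis
  have lip: "\<bar>\<psi> y - \<psi> z\<bar> \<le> L * norm (y - z)" for y z
  proof -
    have "norm (\<psi> y - \<psi> z) \<le> L * norm (y - z)"
    proof (rule differentiable_bound[where S=UNIV and f=\<psi> and f'="\<lambda>x v. v \<bullet> grad \<psi> x"])
      show "(\<psi> has_derivative (\<lambda>v. v \<bullet> grad \<psi> x)) (at x)" for x
        by (rule smooth_has_derivative[OF sm])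
      show "onorm (\<lambda>v. v \<bullet> grad \<psi> x) \<le> L" for x
      proof (rule onorm_le)
        show "norm (v \<bullet> grad \<psi> x) \<le> L * norm v" for v
          using Cauchy_Schwarz_ineq2[of v "grad \<psi> x"] mult_left_mono[OF L(2)[of x], of "norm v"]
          by (simp add: mult.commute)
      qed
    qed auto
    then show ?thesis by simp
  qed
  show "((\<lambda>y. norm (conv u \<psi> y - conv u \<psi> x - conv u (\<lambda>z. grad \<psi> z \<bullet> (y - x)) x) / norm (y - x))
      \<longlongrightarrow> 0) (at x)"
    unfolding tendsto_at_iff_sequentially
  proof (intro allI impI)
    fix X :: "nat \<Rightarrow> 'a"
    assume "\<forall>i. X i \<in> UNIV - {x}" and X: "X \<longlonglongrightarrow> x"
    then have neq: "X i \<noteq> x" for i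
      by auto
    obtain B where B: "norm (X i) \<le> B" for i
      using convergent_imp_Bseq[OF convergentI[OF X]] unfolding Bseq_def by blast
    define q where "q k y = u y * ((\<psi> (X k - y) - \<psi> (x - y) - grad \<psi> (x - y) \<bullet> (X k - x)) / norm (X k - x))"
      for k y
    have "integrable lebesgue (\<lambda>y. (u y * \<psi> (X k - y) - u y * \<psi> (x - y)
        - u y * (grad \<psi> (x - y) \<bullet> (X k - x))) / norm (X k - x))" for k
      by (intro integrable_divide Bochner_Integration.integrable_diff int integrable_conv u \<psi>)
    then have int_q: "integrable lebesgue (q k)" for k
      unfolding q_def[abs_def] by (simp add: algebra_simps)
    have eq: "conv u \<psi> (X k) - conv u \<psi> x - conv u (\<lambda>z. grad \<psi> z \<bullet> (X k - x)) x
        = (LINT y|lebesgue. q k y) * norm (X k - x)" for k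
    proof -
      have "(LINT y|lebesgue. q k y) * norm (X k - x) = (LINT y|lebesgue. u y * \<psi> (X k - y)
          - u y * \<psi> (x - y) - u y * (grad \<psi> (x - y) \<bullet> (X k - x)))"
        by (subst integral_mult_left_zero[symmetric], rule Bochner_Integration.integral_cong)
          (use neq[of k] in \<open>simp_all add: q_def right_diff_distrib\<close>)
      then show ?thesis
        unfolding conv_def
        by (simp add: int integrable_conv u \<psi>)
    qed
    define R where "R = \<bar>r\<bar> + \<bar>B\<bar> + norm x"
    have "(\<lambda>k. LINT y|lebesgue. q k y) \<longlonglongrightarrow> (LINT (y::'a)|lebesgue. 0)"
    proof (rule integral_dominated_convergence)
      show "integrable lebesgue (\<lambda>y. 2 * L * norm (indicator (cball 0 R) y *\<^sub>R u y))"
        by (intro integrable_mult_right integrable_norm L1_loc_integrable_cball u)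
      show "q k \<in> borel_measurable lebesgue" for k
        using int_q by blast
      show "AE y in lebesgue. (\<lambda>k. q k y) \<longlonglongrightarrow> 0"
      proof (rule AE_I2)
        fix y
        have D: "((\<lambda>z. norm (\<psi> z - \<psi> (x - y) - (z - (x - y)) \<bullet> grad \<psi> (x - y)) / norm (z - (x - y))) \<longlongrightarrow> 0)
            (at (x - y))"
          using smooth_has_derivative[OF sm, of "x - y"] unfolding has_derivative_iff_norm by blast
        have "(\<lambda>k. X k - y) \<longlonglongrightarrow> x - y"
          by (intro tendsto_intros X)
        then have "(\<lambda>k. norm (\<psi> (X k - y) - \<psi> (x - y) - (X k - y - (x - y)) \<bullet> grad \<psi> (x - y))
            / norm (X k - y - (x - y))) \<longlonglongrightarrow> 0"
          using D[unfolded tendsto_at_iff_sequentially, rule_format, of "\<lambda>k. X k - y"] neq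
          by (simp add: o_def)
        then have "(\<lambda>k. \<bar>(\<psi> (X k - y) - \<psi> (x - y) - grad \<psi> (x - y) \<bullet> (X k - x)) / norm (X k - x)\<bar>) \<longlonglongrightarrow> 0"
          by (simp add: inner_commute abs_divide)
        then have "(\<lambda>k. (\<psi> (X k - y) - \<psi> (x - y) - grad \<psi> (x - y) \<bullet> (X k - x)) / norm (X k - x)) \<longlonglongrightarrow> 0"
          by (rule tendsto_rabs_zero_cancel)
        then show "(\<lambda>k. q k y) \<longlonglongrightarrow> 0"
          unfolding q_def by (rule tendsto_mult_right_zero)
      qed
      show "AE y in lebesgue. norm (q k y) \<le> 2 * L * norm (indicator (cball 0 R) y *\<^sub>R u y)" for k
      proof (rule AE_I2)
        fix y
        show "norm (q k y) \<le> 2 * L * norm (indicator (cball 0 R) y *\<^sub>R u y)"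
        proof (cases "norm y \<le> R")
          case True
          have "\<bar>grad \<psi> (x - y) \<bullet> (X k - x)\<bar> \<le> L * norm (X k - x)"
            using Cauchy_Schwarz_ineq2[of "grad \<psi> (x - y)" "X k - x"]
              mult_right_mono[OF L(2)[of "x - y"], of "norm (X k - x)"] by simp
          moreover have "\<bar>\<psi> (X k - y) - \<psi> (x - y)\<bar> \<le> L * norm (X k - x)"
            using lip[of "X k - y" "x - y"] by simp
          ultimately have "\<bar>\<psi> (X k - y) - \<psi> (x - y) - grad \<psi> (x - y) \<bullet> (X k - x)\<bar> \<le> 2 * L * norm (X k - x)"
            by linarith
          then have le: "\<bar>\<psi> (X k - y) - \<psi> (x - y) - grad \<psi> (x - y) \<bullet> (X k - x)\<bar> / norm (X k - x) \<le> 2 * L"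
            using neq[of k] by (simp add: divide_le_eq)
          show ?thesis
            using True mult_left_mono[OF le, of "\<bar>u y\<bar>"]
            by (simp add: q_def abs_mult mult.commute)
        next
          case False
          have "norm (X k - y) > r"
            using False B[of k] norm_triangle_ineq2[of y "X k"] norm_ge_zero[of x]
            unfolding R_def norm_minus_commute[of "X k"] by linarith
          moreover have "norm (x - y) > r"
            using False norm_triangle_ineq2[of y x] unfolding R_def
            by (simp add: norm_minus_commute)
          ultimately show ?thesis
            using L(1) by (simp add: q_def r)
        qed
      qed
    qed auto
    then have "(\<lambda>k. \<bar>LINT y|lebesgue. q k y\<bar>) \<longlonglongrightarrow> 0"
      by (simp add: tendsto_rabs_zero)
    then show "((\<lambda>y. norm (conv u \<psi> y - conv u \<psi> x - conv u (\<lambda>z. grad \<psi> z \<bullet> (y - x)) x) / norm (y - x))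
        \<circ> X) \<longlonglongrightarrow> 0"
      unfolding o_def eq using neq by (simp add: abs_mult)
  qed
qed

lemma smooth_conv:
  assumes u: "u \<in> L1_loc" and \<psi>: "\<psi> \<in> test_functions"
  shows "smooth (conv u \<psi>)"
proof
  fix n
  show "times_cont_diff n (conv u \<psi>)"
    using \<psi>
  proof (induction n arbitrary: \<psi>)
    case 0
    show ?case
      using has_derivative_continuous[OF conv_has_derivative[OF u 0]]
      by (simp add: continuous_on_eq_continuous_within)
  next
    case (Suc n)
    show ?case
      by (rule times_cont_diff_SucI[OF conv_has_derivative[OF u Suc.prems]])
        (rule Suc.IH[OF test_function_grad_inner[OF Suc.prems]])
  qed
qed

text \<open>The definition of the weak gradient is applied to the test function \<open>y \<mapsto> \<psi> (x - y)\<close>.\<close>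

lemma grad_conv:
  assumes "has_weak_gradient u G" and \<psi>: "\<psi> \<in> test_functions"
  shows "grad (conv u \<psi>) x \<bullet> v = conv (\<lambda>y. G y \<bullet> v) \<psi> x"
proof -
  have u: "u \<in> L1_loc" and G: "G \<in> L1_loc"
    and weak: "\<And>\<psi>. \<psi> \<in> test_functions \<Longrightarrow>
      (LINT x|lebesgue. u x *\<^sub>R grad \<psi> x) = - (LINT x|lebesgue. \<psi> x *\<^sub>R G x)"
    using assms(1) by (auto simp: has_weak_gradient_def)
  note sm = test_function_smooth[OF \<psi>]
  obtain r where r: "\<And>x. norm x > r \<Longrightarrow> \<psi> x = 0" "\<And>x. norm x > r \<Longrightarrow> grad \<psi> x = 0"
    using test_function_support[OF \<psi>] by metis
  have far: "norm (x - y) > r" if "norm y > r + norm x" for y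
    using that norm_triangle_ineq2[of y x] by (simp add: norm_minus_commute)
  define \<eta> where "\<eta> y = \<psi> (x + - 1 *\<^sub>R y)" for y
  have test_\<eta>: "\<eta> \<in> test_functions"
    unfolding \<eta>_def by (rule test_function_affine[OF \<psi>]) auto
  have grad_\<eta>: "grad \<eta> y = - grad \<psi> (x - y)" for y
    unfolding \<eta>_def by (subst grad_affine[OF sm]) simp
  have int1: "integrable lebesgue (\<lambda>y. u y *\<^sub>R grad \<eta> y)"
    using smooth_continuous_grad[OF test_function_smooth[OF test_\<eta>]] r(2) far
    by (intro integrable_L1_loc_times_continuous[OF u]) (auto simp: grad_\<eta>)
  have int2: "integrable lebesgue (\<lambda>y. \<eta> y *\<^sub>R G y)"
  proof -
    have "\<eta> y *\<^sub>R G y = (\<Sum>b\<in>Basis. (G y \<bullet> b * \<eta> y) *\<^sub>R b)" for y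
      by (subst (1) euclidean_representation[symmetric, of "G y"])
        (simp add: scaleR_sum_right mult.commute)
    then show ?thesis
      using integrable_L1_loc_times_test[OF L1_loc_inner[OF G] test_\<eta>] by simp
  qed
  have "grad (conv u \<psi>) x \<bullet> v = conv u (\<lambda>z. grad \<psi> z \<bullet> v) x"
    using has_derivative_unique[OF smooth_has_derivative[OF smooth_conv[OF u \<psi>]]
        conv_has_derivative[OF u \<psi>]] by (metis inner_commute)
  also have "\<dots> = - (LINT y|lebesgue. u y *\<^sub>R grad \<eta> y) \<bullet> v"
    using integral_inner_left[of v lebesgue, OF int1] by (simp add: conv_def grad_\<eta>)
  also have "\<dots> = (LINT y|lebesgue. \<eta> y *\<^sub>R G y) \<bullet> v"
    by (simp add: weak[OF test_\<eta>])
  also have "\<dots> = conv (\<lambda>y. G y \<bullet> v) \<psi> x"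
    using integral_inner_left[of v lebesgue, OF int2] by (simp add: conv_def \<eta>_def mult.commute)
  finally show ?thesis .
qed

section \<open>Local Lebesgue spaces\<close>

lemma L2_locD:
  assumes "u \<in> L2_loc"
  shows "u \<in> borel_measurable lebesgue"
    and "set_integrable lebesgue (cball 0 r) (\<lambda>x. (norm (u x))\<^sup>2)"
  using assms by (auto simp: L2_loc_def)

lemma L2_loc_real_integrable_sq:
  fixes u :: "'a::euclidean_space \<Rightarrow> real"
  shows "u \<in> L2_loc \<Longrightarrow> set_integrable lebesgue (cball 0 r) (\<lambda>x. (u x)\<^sup>2)"
  using L2_locD(2)[of u r] by simp

lemma set_integrable_dominated:
  fixes f :: "'a::euclidean_space \<Rightarrow> 'b::euclidean_space" and g :: "'a \<Rightarrow> real"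
  assumes "set_integrable lebesgue K g" "f \<in> borel_measurable lebesgue" "K \<in> sets lebesgue"
    and "AE x in lebesgue. x \<in> K \<longrightarrow> norm (f x) \<le> g x"
  shows "set_integrable lebesgue K f"
proof (rule set_integrable_bound[OF assms(1)])
  show "set_borel_measurable lebesgue K f"
    unfolding set_borel_measurable_def using assms(2,3) by measurable
  show "AE x in lebesgue. x \<in> K \<longrightarrow> norm (f x) \<le> norm (g x)"
    using assms(4) by eventually_elim auto
qed

lemma compact_sets_lebesgue: "compact K \<Longrightarrow> K \<in> sets lebesgue"
  by (simp add: borel_compact)

lemma set_integrable_const_compact:
  fixes K :: "'a::euclidean_space set" and c :: real
  assumes "compact K"
  shows "set_integrable lebesgue K (\<lambda>x. c)"
proof -
  have "integrable lborel (\<lambda>x. indicator K x *\<^sub>R c)"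
    by (rule borel_integrable_compact[OF assms]) auto
  then show ?thesis
    unfolding set_integrable_def using borel_compact[OF assms]
    by (subst integrable_completion) auto
qed

lemma norm_add_sq_le: "(norm (a + b))\<^sup>2 \<le> 2 * (norm a)\<^sup>2 + 2 * (norm (b :: 'b::real_normed_vector))\<^sup>2"
proof -
  have "(norm (a + b))\<^sup>2 \<le> (norm a + norm b)\<^sup>2"
    by (intro power_mono norm_triangle_ineq) simp
  also have "\<dots> \<le> 2 * (norm a)\<^sup>2 + 2 * (norm b)\<^sup>2"
    using sum_squares_bound[of "norm a" "norm b"] by (simp add: power2_sum)
  finally show ?thesis .
qed

lemma L2_loc_dominated:
  fixes u :: "'a::euclidean_space \<Rightarrow> 'b::euclidean_space" and v :: "'a \<Rightarrow> 'c::euclidean_space"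
  assumes "v \<in> L2_loc" "u \<in> borel_measurable lebesgue"
    and bound: "\<And>K. compact K \<Longrightarrow> \<exists>M. AE x in lebesgue. x \<in> K \<longrightarrow> norm (u x) \<le> M * norm (v x)"
  shows "u \<in> L2_loc"
  unfolding L2_loc_def
proof (intro CollectI conjI allI impI)
  show [measurable]: "u \<in> borel_measurable lebesgue" by fact
  fix K :: "'a set"
  assume K: "compact K"
  obtain M where M: "AE x in lebesgue. x \<in> K \<longrightarrow> norm (u x) \<le> M * norm (v x)"
    using bound[OF K] by blast
  show "set_integrable lebesgue K (\<lambda>x. (norm (u x))\<^sup>2)"
  proof (rule set_integrable_dominated[where g="\<lambda>x. M\<^sup>2 * (norm (v x))\<^sup>2"])
    show "set_integrable lebesgue K (\<lambda>x. M\<^sup>2 * (norm (v x))\<^sup>2)"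
      using assms(1) K by (auto simp: L2_loc_def)
    show "AE x in lebesgue. x \<in> K \<longrightarrow> norm ((norm (u x))\<^sup>2) \<le> M\<^sup>2 * (norm (v x))\<^sup>2"
      using M
    proof eventually_elim
      fix x
      assume le: "x \<in> K \<longrightarrow> norm (u x) \<le> M * norm (v x)"
      show "x \<in> K \<longrightarrow> norm ((norm (u x))\<^sup>2) \<le> M\<^sup>2 * (norm (v x))\<^sup>2"
        using power_mono[of "norm (u x)" "M * norm (v x)" 2] le by (auto simp: power_mult_distrib)
    qed
  qed (auto simp: K compact_sets_lebesgue)
qed

lemma L2_loc_diff:
  fixes u v :: "'a::euclidean_space \<Rightarrow> 'b::euclidean_space"
  assumes "u \<in> L2_loc" "v \<in> L2_loc"
  shows "(\<lambda>x. u x - v x) \<in> L2_loc"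
  unfolding L2_loc_def
proof (intro CollectI conjI allI impI)
  have [measurable]: "u \<in> borel_measurable lebesgue" "v \<in> borel_measurable lebesgue"
    using assms by (auto simp: L2_loc_def)
  show "(\<lambda>x. u x - v x) \<in> borel_measurable lebesgue" by measurable
  fix K :: "'a set"
  assume K: "compact K"
  show "set_integrable lebesgue K (\<lambda>x. (norm (u x - v x))\<^sup>2)"
  proof (rule set_integrable_dominated)
    show "set_integrable lebesgue K (\<lambda>x. 2 * (norm (u x))\<^sup>2 + 2 * (norm (v x))\<^sup>2)"
      using assms K by (auto simp: L2_loc_def)
    show "AE x in lebesgue. x \<in> K \<longrightarrow>
        norm ((norm (u x - v x))\<^sup>2) \<le> 2 * (norm (u x))\<^sup>2 + 2 * (norm (v x))\<^sup>2"
      using norm_add_sq_le[of "u _" "- v _"] by simp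
  qed (auto simp: K compact_sets_lebesgue)
qed

lemma L2_loc_inner:
  "G \<in> L2_loc \<Longrightarrow> (\<lambda>x. G x \<bullet> v) \<in> L2_loc"
  by (rule L2_loc_dominated[of G])
    (auto simp: L2_locD Cauchy_Schwarz_ineq2 mult.commute[of "norm v"] intro!: exI[of _ "norm v"]
      borel_measurable_inner)

lemma L2_loc_norm:
  assumes "G \<in> L2_loc"
  shows "(\<lambda>x. norm (G x)) \<in> L2_loc"
proof (rule L2_loc_dominated[OF assms])
  have [measurable]: "G \<in> borel_measurable lebesgue"
    by (rule L2_locD(1)[OF assms])
  show "(\<lambda>x. norm (G x)) \<in> borel_measurable lebesgue"
    by measurable
qed (auto intro!: exI[of _ 1])

lemma L2_loc_Linf_loc_mult:
  fixes b :: "'a::euclidean_space \<Rightarrow> real"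
  assumes "G \<in> L2_loc" "b \<in> Linf_loc"
  shows "(\<lambda>x. b x *\<^sub>R G x) \<in> L2_loc"
proof (rule L2_loc_dominated[OF assms(1)])
  show "(\<lambda>x. b x *\<^sub>R G x) \<in> borel_measurable lebesgue"
    using assms by (auto simp: L2_loc_def Linf_loc_def)
  fix K :: "'a set"
  assume "compact K"
  then obtain M where "AE x in lebesgue. x \<in> K \<longrightarrow> norm (b x) \<le> M"
    using assms(2) by (auto simp: Linf_loc_def)
  then have "AE x in lebesgue. x \<in> K \<longrightarrow> norm (b x *\<^sub>R G x) \<le> M * norm (G x)"
    by eventually_elim (auto intro: mult_right_mono)
  then show "\<exists>M. AE x in lebesgue. x \<in> K \<longrightarrow> norm (b x *\<^sub>R G x) \<le> M * norm (G x)" ..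
qed

lemma Linf_loc_sq:
  fixes b :: "'a::euclidean_space \<Rightarrow> real"
  assumes "b \<in> Linf_loc"
  shows "(\<lambda>x. (b x)\<^sup>2) \<in> Linf_loc"
  unfolding Linf_loc_def
proof (intro CollectI conjI allI impI)
  show "(\<lambda>x. (b x)\<^sup>2) \<in> borel_measurable lebesgue"
    using assms by (auto simp: Linf_loc_def)
  fix K :: "'a set"
  assume "compact K"
  then obtain M where "AE x in lebesgue. x \<in> K \<longrightarrow> norm (b x) \<le> M"
    using assms by (auto simp: Linf_loc_def)
  then have "AE x in lebesgue. x \<in> K \<longrightarrow> norm ((b x)\<^sup>2) \<le> M\<^sup>2"
  proof eventually_elim
    fix x
    show "x \<in> K \<longrightarrow> norm (b x) \<le> M \<Longrightarrow> x \<in> K \<longrightarrow> norm ((b x)\<^sup>2) \<le> M\<^sup>2"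
      using power_mono[of "\<bar>b x\<bar>" M 2] by simp
  qed
  then show "\<exists>M. AE x in lebesgue. x \<in> K \<longrightarrow> norm ((b x)\<^sup>2) \<le> M" ..
qed

lemma L2_loc_continuous:
  fixes b :: "'a::euclidean_space \<Rightarrow> 'b::euclidean_space"
  assumes "continuous_on UNIV b"
  shows "b \<in> L2_loc"
  unfolding L2_loc_def
proof (intro CollectI conjI allI impI)
  show m[measurable]: "b \<in> borel_measurable lebesgue"
    by (rule measurable_lebesgue_if_continuous[OF assms])
  fix K :: "'a set"
  assume K: "compact K"
  have "integrable lborel (\<lambda>x. indicator K x *\<^sub>R (norm (b x))\<^sup>2)"
    by (rule borel_integrable_compact[OF K]) (auto intro!: continuous_intros continuous_on_subset[OF assms])
  then show "set_integrable lebesgue K (\<lambda>x. (norm (b x))\<^sup>2)"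
    unfolding set_integrable_def using borel_compact[OF K] assms
    by (subst integrable_completion) (auto intro!: borel_measurable_continuous_onI)
qed

lemma L2_loc_imp_L1_loc:
  fixes u :: "'a::euclidean_space \<Rightarrow> 'b::euclidean_space"
  assumes "u \<in> L2_loc"
  shows "u \<in> L1_loc"
  unfolding L1_loc_def
proof (intro CollectI allI impI)
  fix K :: "'a set"
  assume K: "compact K"
  show "set_integrable lebesgue K u"
  proof (rule set_integrable_dominated)
    show "set_integrable lebesgue K (\<lambda>x. 1 + (norm (u x))\<^sup>2)"
      using assms K by (auto simp: L2_loc_def intro: set_integrable_const_compact)
    have "norm (u x) \<le> 1 + (norm (u x))\<^sup>2" for x
      using sum_squares_bound[of "norm (u x)" 1] norm_ge_zero[of "u x"] by (simp del: norm_ge_zero)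
    then show "AE x in lebesgue. x \<in> K \<longrightarrow> norm (u x) \<le> 1 + (norm (u x))\<^sup>2" by simp
  qed (use assms K in \<open>auto simp: compact_sets_lebesgue L2_loc_def\<close>)
qed

lemma set_integrable_L2_mult:
  fixes u v :: "'a::euclidean_space \<Rightarrow> real"
  assumes "u \<in> L2_loc" "v \<in> L2_loc"
  shows "set_integrable lebesgue (cball 0 r) (\<lambda>x. u x * v x)"
proof (rule set_integrable_dominated)
  show "set_integrable lebesgue (cball 0 r) (\<lambda>x. (u x)\<^sup>2 + (v x)\<^sup>2)"
    by (intro set_integral_add L2_loc_real_integrable_sq assms)
  have "\<bar>u x * v x\<bar> \<le> (u x)\<^sup>2 + (v x)\<^sup>2" for x
  proof -
    have "2 * \<bar>u x * v x\<bar> \<le> (u x)\<^sup>2 + (v x)\<^sup>2"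
      using sum_squares_bound[of "\<bar>u x\<bar>" "\<bar>v x\<bar>"] by (simp add: abs_mult)
    then show ?thesis
      using abs_ge_zero[of "u x * v x"] by linarith
  qed
  then show "AE x in lebesgue. x \<in> cball 0 r \<longrightarrow> norm (u x * v x) \<le> (u x)\<^sup>2 + (v x)\<^sup>2"
    by simp
  show "(\<lambda>x. u x * v x) \<in> borel_measurable lebesgue"
    using assms by (auto simp: L2_loc_def)
qed auto

lemma L1_locI_cball:
  fixes u :: "'a::euclidean_space \<Rightarrow> 'b::euclidean_space"
  assumes "\<And>r. set_integrable lebesgue (cball 0 r) u"
  shows "u \<in> L1_loc"
  unfolding L1_loc_def
proof (intro CollectI allI impI)
  fix K :: "'a set"
  assume K: "compact K"
  from compact_imp_bounded[OF this] obtain r where "\<forall>x\<in>K. norm x \<le> r"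
    unfolding bounded_iff by blast
  then have "K \<subseteq> cball 0 r"
    by auto
  then show "set_integrable lebesgue K u"
    using set_integrable_subset[OF assms] compact_sets_lebesgue[OF K] by blast
qed

lemma L1_loc_add:
  fixes u v :: "'a::euclidean_space \<Rightarrow> real"
  shows "u \<in> L1_loc \<Longrightarrow> v \<in> L1_loc \<Longrightarrow> (\<lambda>x. u x + v x) \<in> L1_loc"
  by (auto simp: L1_loc_def)

lemma L1_loc_sum:
  fixes u :: "'i \<Rightarrow> 'a::euclidean_space \<Rightarrow> real"
  assumes "finite I" "\<And>i. i \<in> I \<Longrightarrow> u i \<in> L1_loc"
  shows "(\<lambda>x. \<Sum>i\<in>I. u i x) \<in> L1_loc"
  using assms
proof (induction I rule: finite_induct)
  case empty
  then show ?case by (simp add: L1_loc_def set_integrable_def)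
qed (simp add: L1_loc_add)

lemma L1_loc_L2_inner:
  fixes u v :: "'a::euclidean_space \<Rightarrow> 'b::euclidean_space"
  assumes "u \<in> L2_loc" "v \<in> L2_loc"
  shows "(\<lambda>x. u x \<bullet> v x) \<in> L1_loc"
proof (rule L1_locI_cball)
  fix r
  show "set_integrable lebesgue (cball 0 r) (\<lambda>x. u x \<bullet> v x)"
  proof (rule set_integrable_dominated)
    show "set_integrable lebesgue (cball 0 r) (\<lambda>x. norm (u x) * norm (v x))"
      by (intro set_integrable_L2_mult L2_loc_norm assms)
    show "(\<lambda>x. u x \<bullet> v x) \<in> borel_measurable lebesgue"
      by (rule borel_measurable_inner[OF L2_locD(1)[OF assms(1)] L2_locD(1)[OF assms(2)]])
  qed (auto simp: Cauchy_Schwarz_ineq2)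
qed

lemma L1_loc_L2_scaleR:
  fixes u :: "'a::euclidean_space \<Rightarrow> real" and v :: "'a \<Rightarrow> 'b::euclidean_space"
  assumes "u \<in> L2_loc" "v \<in> L2_loc"
  shows "(\<lambda>x. u x *\<^sub>R v x) \<in> L1_loc"
proof (rule L1_locI_cball)
  fix r
  show "set_integrable lebesgue (cball 0 r) (\<lambda>x. u x *\<^sub>R v x)"
  proof (rule set_integrable_dominated)
    show "set_integrable lebesgue (cball 0 r) (\<lambda>x. norm (u x) * norm (v x))"
      by (intro set_integrable_L2_mult L2_loc_norm assms)
    show "(\<lambda>x. u x *\<^sub>R v x) \<in> borel_measurable lebesgue"
      by (rule borel_measurable_scaleR[OF L2_locD(1)[OF assms(1)] L2_locD(1)[OF assms(2)]])
  qed auto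
qed

lemma integrable_L1_loc_inner_grad:
  fixes v :: "'a::euclidean_space \<Rightarrow> 'a"
  assumes "v \<in> L1_loc" "\<theta> \<in> test_functions"
  shows "integrable lebesgue (\<lambda>x. v x \<bullet> grad \<theta> x)"
  by (subst euclidean_inner, intro Bochner_Integration.integrable_sum integrable_L1_loc_times_test L1_loc_inner
      test_function_grad_inner assms)

lemma L1_loc_set_integrable_subset_cball:
  fixes e :: "'a::euclidean_space \<Rightarrow> real"
  assumes "e \<in> L1_loc" "S \<in> sets lebesgue" "S \<subseteq> cball 0 r"
  shows "set_integrable lebesgue S e"
  using assms set_integrable_subset[of lebesgue "cball 0 r" e S] by (auto simp: L1_loc_def)

lemma integral_nonpos_if_AE:
  fixes F :: "'b \<Rightarrow> real"
  assumes "AE x in M. F x \<le> 0"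
  shows "integral\<^sup>L M F \<le> 0"
proof -
  have "0 \<le> integral\<^sup>L M (\<lambda>x. - F x)"
    using assms by (intro integral_nonneg_AE) (auto elim: eventually_mono)
  then show ?thesis
    by simp
qed

lemma set_dominated_convergence:
  fixes f :: "'a::euclidean_space \<Rightarrow> real" and w :: "'a \<Rightarrow> real"
  assumes "set_integrable lebesgue (cball 0 r) w"
    and [measurable]: "f \<in> borel_measurable lebesgue" "\<And>n. s n \<in> borel_measurable lebesgue"
    and lim: "AE x in lebesgue. x \<in> cball 0 r \<longrightarrow> (\<lambda>n. s n x) \<longlonglongrightarrow> f x"
    and bound: "\<And>n. AE x in lebesgue. x \<in> cball 0 r \<longrightarrow> \<bar>s n x\<bar> \<le> w x"
  shows "(\<lambda>n. LINT x:cball 0 r|lebesgue. s n x) \<longlonglongrightarrow> (LINT x:cball 0 r|lebesgue. f x)"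
  unfolding set_lebesgue_integral_def
proof (rule integral_dominated_convergence)
  show "integrable lebesgue (\<lambda>x. indicator (cball 0 r) x *\<^sub>R w x)"
    using assms(1) by (simp add: set_integrable_def)
  show "AE x in lebesgue. (\<lambda>n. indicator (cball 0 r) x *\<^sub>R s n x) \<longlonglongrightarrow> indicator (cball 0 r) x *\<^sub>R f x"
    using lim by eventually_elim (auto simp: indicator_def)
  show "AE x in lebesgue. norm (indicator (cball 0 r) x *\<^sub>R s n x) \<le> indicator (cball 0 r) x *\<^sub>R w x" for n
    using bound[of n] by eventually_elim (auto simp: indicator_def)
qed (use assms(2,3) in \<open>auto intro!: borel_measurable_times borel_measurable_indicator\<close>)

lemma integral_eq_set_integral_cball:
  fixes F :: "'a::euclidean_space \<Rightarrow> real"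
  assumes "\<And>x. norm x > r \<Longrightarrow> F x = 0"
  shows "(LINT x|lebesgue. F x) = (LINT x:cball 0 r|lebesgue. F x)"
  unfolding set_lebesgue_integral_def
  by (rule Bochner_Integration.integral_cong) (use assms in \<open>auto simp: indicator_def not_le\<close>)

section \<open>Mollification in \<open>L\<^sup>2\<close>\<close>

text \<open>A measurable function is an almost everywhere limit of continuous functions. Truncating all of
  them at a common height \<open>k\<close> keeps them continuous and provides the dominating constant.\<close>

lemma L2_loc_approx_continuous:
  fixes w :: "'a::euclidean_space \<Rightarrow> real"
  assumes w: "w \<in> L2_loc" and "\<epsilon> > 0"
  obtains g where "continuous_on UNIV g" "(LINT x:cball 0 r|lebesgue. (w x - g x)\<^sup>2) < \<epsilon>"
proof -
  have [measurable]: "w \<in> borel_measurable lebesgue"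
    using w by (rule L2_locD)
  define c where "c k t = max (- real k) (min (real k) t)" for k t
  have c_cont: "continuous_on UNIV (c k)" for k
    unfolding c_def by (intro continuous_intros)
  have c_meas[measurable]: "c k \<in> borel_measurable borel" for k
    by (rule borel_measurable_continuous_onI[OF c_cont])
  have c_bound: "\<bar>c k t\<bar> \<le> k" for k t
    by (auto simp: c_def)
  have c_lim: "(\<lambda>k. c k t) \<longlonglongrightarrow> t" for t
  proof (rule tendsto_eventually)
    obtain k0 where "\<bar>t\<bar> \<le> real k0"
      using real_arch_simple by blast
    then have "\<forall>k\<ge>k0. c k t = t"
      by (auto simp: c_def)
    then show "\<forall>\<^sub>F k in sequentially. c k t = t"
      by (auto simp: eventually_sequentially)
  qed
  have "(\<lambda>k. LINT x:cball 0 r|lebesgue. (w x - c k (w x))\<^sup>2) \<longlonglongrightarrow> (LINT x:cball (0::'a) r|lebesgue. 0)"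
  proof (rule set_dominated_convergence[OF L2_loc_real_integrable_sq[OF w]])
    show "AE x in lebesgue. x \<in> cball 0 r \<longrightarrow> (\<lambda>k. (w x - c k (w x))\<^sup>2) \<longlonglongrightarrow> 0"
    proof (intro AE_I2 impI)
      show "(\<lambda>k. (w x - c k (w x))\<^sup>2) \<longlonglongrightarrow> 0" for x
        using tendsto_power[OF tendsto_diff[OF tendsto_const c_lim], of "w x" "w x" 2] by simp
    qed
    have "\<bar>w x - c k (w x)\<bar> \<le> \<bar>w x\<bar>" for x k
      by (auto simp: c_def)
    then have "(w x - c k (w x))\<^sup>2 \<le> (w x)\<^sup>2" for x k
      by (simp add: abs_le_square_iff)
    then show "AE x in lebesgue. x \<in> cball 0 r \<longrightarrow> \<bar>(w x - c k (w x))\<^sup>2\<bar> \<le> (w x)\<^sup>2" for k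
      by simp
  qed measurable
  then have "\<forall>\<^sub>F k in sequentially. (LINT x:cball 0 r|lebesgue. (w x - c k (w x))\<^sup>2) < \<epsilon> / 4"
    using assms(2) by (intro order_tendstoD(2)[of _ 0]) (auto simp: set_lebesgue_integral_def)
  then obtain k where k: "(LINT x:cball 0 r|lebesgue. (w x - c k (w x))\<^sup>2) < \<epsilon> / 4"
    by (auto simp: eventually_sequentially)
  obtain N h where N: "negligible N" and h: "\<And>n. continuous_on UNIV (h n)"
    and h_lim: "\<And>x. x \<notin> N \<Longrightarrow> (\<lambda>n. h n x) \<longlonglongrightarrow> w x"
    using lebesgue_measurable_imp_measurable_on[of w UNIV] by (auto simp: measurable_on_def)
  have h_meas[measurable]: "h n \<in> borel_measurable lebesgue" for n
    by (rule measurable_lebesgue_if_continuous[OF h])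
  have N': "AE x in lebesgue. x \<notin> N"
    using N by (simp add: negligible_iff_null_sets AE_not_in)
  have "(\<lambda>n. LINT x:cball 0 r|lebesgue. (c k (w x) - c k (h n x))\<^sup>2) \<longlonglongrightarrow> (LINT x:cball (0::'a) r|lebesgue. 0)"
  proof (rule set_dominated_convergence)
    show "set_integrable lebesgue (cball (0::'a) r) (\<lambda>x. (2 * real k)\<^sup>2)"
      by (rule set_integrable_const_compact) simp
    show "AE x in lebesgue. x \<in> cball 0 r \<longrightarrow> (\<lambda>n. (c k (w x) - c k (h n x))\<^sup>2) \<longlonglongrightarrow> 0"
      using N'
    proof eventually_elim
      fix x
      assume "x \<notin> N"
      then have "(\<lambda>n. c k (h n x)) \<longlonglongrightarrow> c k (w x)"
        by (intro continuous_on_tendsto_compose[OF c_cont] h_lim) auto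
      from tendsto_power[OF tendsto_diff[OF tendsto_const this], of "c k (w x)" 2]
      show "x \<in> cball 0 r \<longrightarrow> (\<lambda>n. (c k (w x) - c k (h n x))\<^sup>2) \<longlonglongrightarrow> 0"
        by simp
    qed
    have "\<bar>c k s - c k t\<bar> \<le> \<bar>2 * real k\<bar>" for s t
      using c_bound[of k s] c_bound[of k t] by linarith
    then have "(c k s - c k t)\<^sup>2 \<le> (2 * real k)\<^sup>2" for s t
      by (simp only: abs_le_square_iff)
    then show "AE x in lebesgue. x \<in> cball 0 r \<longrightarrow> \<bar>(c k (w x) - c k (h n x))\<^sup>2\<bar> \<le> (2 * real k)\<^sup>2" for n
      by simp
  qed measurable
  then have "\<forall>\<^sub>F n in sequentially. (LINT x:cball 0 r|lebesgue. (c k (w x) - c k (h n x))\<^sup>2) < \<epsilon> / 4"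
    using assms(2) by (intro order_tendstoD(2)[of _ 0]) (auto simp: set_lebesgue_integral_def)
  then obtain n where n: "(LINT x:cball 0 r|lebesgue. (c k (w x) - c k (h n x))\<^sup>2) < \<epsilon> / 4"
    by (auto simp: eventually_sequentially)
  define g where "g x = c k (h n x)" for x
  have g: "continuous_on UNIV g"
    unfolding g_def by (rule continuous_on_compose2[OF c_cont h]) simp
  have cw: "(\<lambda>x. c k (w x)) \<in> L2_loc"
  proof (rule L2_loc_dominated[OF w])
    have "\<bar>c k t\<bar> \<le> \<bar>t\<bar>" for t
      by (auto simp: c_def)
    then show "\<exists>M. AE x in lebesgue. x \<in> K \<longrightarrow> norm (c k (w x)) \<le> M * norm (w x)" for K
      by (intro exI[of _ 1]) auto
  qed measurable
  have i1: "set_integrable lebesgue (cball 0 r) (\<lambda>x. (w x - c k (w x))\<^sup>2)"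
    by (intro L2_loc_real_integrable_sq L2_loc_diff w cw)
  have i2: "set_integrable lebesgue (cball 0 r) (\<lambda>x. (c k (w x) - g x)\<^sup>2)"
    by (intro L2_loc_real_integrable_sq L2_loc_diff cw L2_loc_continuous g)
  have i3: "set_integrable lebesgue (cball 0 r) (\<lambda>x. (w x - g x)\<^sup>2)"
    by (intro L2_loc_real_integrable_sq L2_loc_diff w L2_loc_continuous g)
  have "(LINT x:cball 0 r|lebesgue. (w x - g x)\<^sup>2)
      \<le> (LINT x:cball 0 r|lebesgue. 2 * (w x - c k (w x))\<^sup>2 + 2 * (c k (w x) - g x)\<^sup>2)"
  proof (rule set_integral_mono[OF i3])
    show "(w x - g x)\<^sup>2 \<le> 2 * (w x - c k (w x))\<^sup>2 + 2 * (c k (w x) - g x)\<^sup>2" for x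
      using norm_add_sq_le[of "w x - c k (w x)" "c k (w x) - g x"] by simp
  qed (use i1 i2 in auto)
  also have "\<dots> < \<epsilon>"
    using i1 i2 k n by (simp add: g_def)
  finally show thesis
    using that g by blast
qed

lemma lborel_distr_reflect:
  fixes x :: "'a::euclidean_space"
  assumes "\<bar>c\<bar> = 1"
  shows "distr lborel borel (\<lambda>y. x + c *\<^sub>R y) = lborel"
  using lborel_affine[of c x] assms by (auto simp: density_1)

lemma nn_integral_lborel_reflect:
  fixes F :: "'a::euclidean_space \<Rightarrow> ennreal"
  assumes "F \<in> borel_measurable borel" "\<bar>c\<bar> = 1"
  shows "(\<integral>\<^sup>+y. F (x + c *\<^sub>R y) \<partial>lborel) = (\<integral>\<^sup>+y. F y \<partial>lborel)"
  using assms(1) nn_integral_distr[of "\<lambda>y. x + c *\<^sub>R y" lborel borel F]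
  by (simp add: lborel_distr_reflect[OF assms(2)])

text \<open>Convolution with a probability density is a contraction of \<open>L\<^sup>2\<close>: by the Cauchy-Schwarz
  inequality for the measure with density \<open>\<rho> (x - y)\<close>, the square of the average is at most the
  average of the square, and the total mass is then computed by exchanging the integrals.\<close>

lemma nn_integral_conv_sq_le:
  fixes W \<rho> :: "'a::euclidean_space \<Rightarrow> real"
  assumes [measurable]: "W \<in> borel_measurable borel" and "W \<in> L1_loc"
    and "is_mollifier \<delta> \<rho>"
  shows "(\<integral>\<^sup>+x. ennreal ((conv W \<rho> x)\<^sup>2) \<partial>lborel) \<le> (\<integral>\<^sup>+y. ennreal ((W y)\<^sup>2) \<partial>lborel)"
proof -
  have \<rho>: "\<rho> \<in> test_functions" "\<And>x. \<rho> x \<ge> 0" "integrable lborel \<rho>" "(LINT x|lborel. \<rho> x) = 1"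
    using assms(3) by (auto simp: is_mollifier_def)
  have [measurable]: "\<rho> \<in> borel_measurable borel"
    by (intro borel_measurable_continuous_onI smooth_continuous test_function_smooth \<rho>)
  have mass: "(\<integral>\<^sup>+y. ennreal (\<rho> y) \<partial>lborel) = 1"
    using nn_integral_eq_integral[OF \<rho>(3)] \<rho>(2,4) by simp
  have mass1: "(\<integral>\<^sup>+y. ennreal (\<rho> (x - y)) \<partial>lborel) = 1" for x
    using nn_integral_lborel_reflect[of "\<lambda>y. ennreal (\<rho> y)" "- 1" x] mass by simp
  have mass2: "(\<integral>\<^sup>+x. ennreal (\<rho> (x - y)) \<partial>lborel) = 1" for y
    using nn_integral_lborel_reflect[of "\<lambda>y. ennreal (\<rho> y)" 1 "- y"] mass by simp
  have jensen: "ennreal ((conv W \<rho> x)\<^sup>2) \<le> (\<integral>\<^sup>+y. ennreal ((W y)\<^sup>2 * \<rho> (x - y)) \<partial>lborel)" for x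
  proof -
    have "integrable lborel (\<lambda>y. W y * \<rho> (x - y))"
      using integrable_conv[OF assms(2) \<rho>(1), of x] by (subst (asm) integrable_completion) auto
    moreover have "conv W \<rho> x = (LINT y|lborel. W y * \<rho> (x - y))"
      unfolding conv_def by (subst integral_completion) auto
    ultimately have "ennreal \<bar>conv W \<rho> x\<bar> \<le> (\<integral>\<^sup>+y. ennreal \<bar>W y * \<rho> (x - y)\<bar> \<partial>lborel)"
      using integral_norm_bound_ennreal[of lborel "\<lambda>y. W y * \<rho> (x - y)"] by simp
    also have "\<dots> = (\<integral>\<^sup>+y. ennreal (\<bar>W y\<bar> * sqrt (\<rho> (x - y))) * ennreal (sqrt (\<rho> (x - y))) \<partial>lborel)"
      using \<rho>(2) by (intro nn_integral_cong) (simp add: abs_mult mult.assoc flip: ennreal_mult)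
    finally have "(ennreal \<bar>conv W \<rho> x\<bar>)\<^sup>2
        \<le> (\<integral>\<^sup>+y. ennreal (\<bar>W y\<bar> * sqrt (\<rho> (x - y))) * ennreal (sqrt (\<rho> (x - y))) \<partial>lborel)\<^sup>2"
      by (rule power_mono) simp
    also have "\<dots> \<le> (\<integral>\<^sup>+y. (ennreal (\<bar>W y\<bar> * sqrt (\<rho> (x - y))))\<^sup>2 \<partial>lborel)
        * (\<integral>\<^sup>+y. (ennreal (sqrt (\<rho> (x - y))))\<^sup>2 \<partial>lborel)"
      by (rule Cauchy_Schwarz_nn_integral) measurable
    also have "\<dots> = (\<integral>\<^sup>+y. ennreal ((W y)\<^sup>2 * \<rho> (x - y)) \<partial>lborel) * (\<integral>\<^sup>+y. ennreal (\<rho> (x - y)) \<partial>lborel)"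
      using \<rho>(2) by (simp add: ennreal_power power_mult_distrib)
    finally show ?thesis
      by (simp add: mass1 ennreal_power)
  qed
  have "(\<integral>\<^sup>+x. ennreal ((conv W \<rho> x)\<^sup>2) \<partial>lborel)
      \<le> (\<integral>\<^sup>+x. (\<integral>\<^sup>+y. ennreal ((W y)\<^sup>2 * \<rho> (x - y)) \<partial>lborel) \<partial>lborel)"
    by (intro nn_integral_mono jensen)
  also have "\<dots> = (\<integral>\<^sup>+y. (\<integral>\<^sup>+x. ennreal ((W y)\<^sup>2 * \<rho> (x - y)) \<partial>lborel) \<partial>lborel)"
    by (rule lborel_pair.Fubini') measurable
  also have "\<dots> = (\<integral>\<^sup>+y. ennreal ((W y)\<^sup>2) * (\<integral>\<^sup>+x. ennreal (\<rho> (x - y)) \<partial>lborel) \<partial>lborel)"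
    using \<rho>(2) by (intro nn_integral_cong) (simp add: ennreal_mult nn_integral_cmult)
  finally show ?thesis
    by (simp add: mass2)
qed

text \<open>On the ball of radius \<open>r\<close> the convolution sees only the values of \<open>w\<close> on the ball of radius \<open>r + 1\<close>,
  so \<open>w\<close> may be cut off there; and it may be replaced by a Borel representative, to which the previous
  lemma applies.\<close>

lemma conv_L2_bound:
  fixes w \<rho> :: "'a::euclidean_space \<Rightarrow> real"
  assumes w: "w \<in> L2_loc" and "is_mollifier \<delta> \<rho>" and "\<delta> \<le> 1"
  shows "(LINT x:cball 0 r|lebesgue. (conv w \<rho> x)\<^sup>2) \<le> (LINT x:cball 0 (r + 1)|lebesgue. (w x)\<^sup>2)"
proof -
  have \<rho>: "\<rho> \<in> test_functions" and supp: "\<And>x. norm x > 1 \<Longrightarrow> \<rho> x = 0"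
    using assms(2,3) by (auto simp: is_mollifier_def)
  obtain w' where [measurable]: "w' \<in> borel_measurable borel" and "AE x in lborel. w x = w' x"
    using completion_ex_borel_measurable_real[OF L2_locD(1)[OF w]] by auto
  then have eq: "AE x in lebesgue. w x = w' x"
    by (auto intro: AE_completion)
  define W where "W x = indicator (cball 0 (r + 1)) x * w' x" for x
  have [measurable]: "cball (0::'a) (r + 1) \<in> sets borel"
    by simp
  have [measurable]: "W \<in> borel_measurable borel"
    unfolding W_def by measurable
  have [measurable]: "W \<in> borel_measurable lebesgue" "w \<in> borel_measurable lebesgue"
    by (auto simp: L2_locD[OF w] intro!: measurable_completion)
  have "W \<in> L2_loc"
  proof (rule L2_loc_dominated[OF w])
    show "\<exists>M. AE x in lebesgue. x \<in> K \<longrightarrow> norm (W x) \<le> M * norm (w x)" for K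
      using eq by (intro exI[of _ 1]) (auto elim!: eventually_mono simp: W_def indicator_def)
  qed measurable
  then have W1: "W \<in> L1_loc"
    by (rule L2_loc_imp_L1_loc)
  have conv_eq: "conv w \<rho> x = conv W \<rho> x" if "x \<in> cball 0 r" for x
    unfolding conv_def
  proof (rule integral_cong_AE)
    have [measurable]: "(\<lambda>y. \<rho> (x - y)) \<in> borel_measurable lebesgue"
      by (intro measurable_lebesgue_if_continuous smooth_continuous test_function_smooth
          test_function_reflect \<rho>)
    show "(\<lambda>y. w y * \<rho> (x - y)) \<in> borel_measurable lebesgue"
      "(\<lambda>y. W y * \<rho> (x - y)) \<in> borel_measurable lebesgue"
      by measurable
    show "AE y in lebesgue. w y * \<rho> (x - y) = W y * \<rho> (x - y)"
      using eq
    proof eventually_elim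
      fix y
      assume "w y = w' y"
      moreover have "norm y \<le> r + 1" if "norm (x - y) \<le> 1"
        using that \<open>x \<in> cball 0 r\<close> norm_triangle_ineq2[of y x] by (simp add: norm_minus_commute)
      ultimately show "w y * \<rho> (x - y) = W y * \<rho> (x - y)"
        using supp[of "x - y"] by (cases "norm (x - y) \<le> 1") (auto simp: W_def)
    qed
  qed
  have int_w: "integrable lebesgue (\<lambda>x. indicator (cball 0 (r + 1)) x *\<^sub>R (w x)\<^sup>2)"
    using L2_loc_real_integrable_sq[OF w] by (simp add: set_integrable_def)
  have "(\<integral>\<^sup>+x. ennreal ((W x)\<^sup>2) \<partial>lborel) = (\<integral>\<^sup>+x. ennreal ((W x)\<^sup>2) \<partial>lebesgue)"
    by (simp add: nn_integral_completion)
  also have "\<dots> = (\<integral>\<^sup>+x. ennreal (indicator (cball 0 (r + 1)) x *\<^sub>R (w x)\<^sup>2) \<partial>lebesgue)"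
    using eq by (intro nn_integral_cong_AE) (auto elim!: eventually_mono simp: W_def indicator_def)
  also have "\<dots> = ennreal (LINT x:cball 0 (r + 1)|lebesgue. (w x)\<^sup>2)"
    unfolding set_lebesgue_integral_def by (rule nn_integral_eq_integral[OF int_w]) auto
  finally have nn_W: "(\<integral>\<^sup>+x. ennreal ((W x)\<^sup>2) \<partial>lborel) = ennreal (LINT x:cball 0 (r + 1)|lebesgue. (w x)\<^sup>2)" .
  have cont: "continuous_on UNIV (conv w \<rho>)" "continuous_on UNIV (conv W \<rho>)"
    by (intro smooth_continuous smooth_conv L2_loc_imp_L1_loc[OF w] W1 \<rho>)+
  have "ennreal (LINT x:cball 0 r|lebesgue. (conv w \<rho> x)\<^sup>2)
      = (\<integral>\<^sup>+x. ennreal (indicator (cball 0 r) x *\<^sub>R (conv w \<rho> x)\<^sup>2) \<partial>lebesgue)"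
    unfolding set_lebesgue_integral_def
    using L2_loc_real_integrable_sq[OF L2_loc_continuous[OF cont(1)]]
    by (intro nn_integral_eq_integral[symmetric]) (auto simp: set_integrable_def)
  also have "\<dots> \<le> (\<integral>\<^sup>+x. ennreal ((conv W \<rho> x)\<^sup>2) \<partial>lebesgue)"
    by (intro nn_integral_mono) (auto simp: indicator_def conv_eq)
  also have "\<dots> = (\<integral>\<^sup>+x. ennreal ((conv W \<rho> x)\<^sup>2) \<partial>lborel)"
    using cont(2) by (subst nn_integral_completion) (auto intro!: borel_measurable_continuous_onI)
  also have "\<dots> \<le> (\<integral>\<^sup>+x. ennreal ((W x)\<^sup>2) \<partial>lborel)"
    by (rule nn_integral_conv_sq_le) (use W1 assms(2) in auto)
  finally show ?thesis
    unfolding nn_W by (subst (asm) ennreal_le_iff)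
      (auto simp: set_lebesgue_integral_def intro!: Bochner_Integration.integral_nonneg)
qed

lemma conv_continuous_approx:
  fixes g :: "'a::euclidean_space \<Rightarrow> real"
  assumes g: "continuous_on UNIV g" and "\<epsilon> > 0"
  obtains d where "d > 0"
    "\<And>\<delta> \<rho> x. is_mollifier \<delta> \<rho> \<Longrightarrow> \<delta> < d \<Longrightarrow> x \<in> cball 0 r \<Longrightarrow> \<bar>conv g \<rho> x - g x\<bar> \<le> \<epsilon>"
proof -
  have "uniformly_continuous_on (cball 0 (r + 1)) g"
    by (intro compact_uniformly_continuous continuous_on_subset[OF g]) auto
  then obtain d where d: "d > 0"
    "\<And>x y. x \<in> cball 0 (r + 1) \<Longrightarrow> y \<in> cball 0 (r + 1) \<Longrightarrow> dist y x < d \<Longrightarrow> dist (g y) (g x) < \<epsilon>"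
    using assms(2) unfolding uniformly_continuous_on_def by meson
  show thesis
  proof
    show "min d 1 > 0"
      using d by simp
    fix \<delta> and \<rho> :: "'a \<Rightarrow> real" and x :: 'a
    assume "is_mollifier \<delta> \<rho>" and \<delta>: "\<delta> < min d 1" and x: "x \<in> cball 0 r"
    then have \<rho>: "\<rho> \<in> test_functions" "\<And>x. \<rho> x \<ge> 0" "\<And>x. norm x \<ge> \<delta> \<Longrightarrow> \<rho> x = 0"
      "integrable lborel \<rho>" "(LINT x|lborel. \<rho> x) = 1"
      by (auto simp: is_mollifier_def)
    have [measurable]: "\<rho> \<in> borel_measurable borel"
      by (intro borel_measurable_continuous_onI smooth_continuous test_function_smooth \<rho>)
    have mass: "(LINT y|lebesgue. \<rho> (x - y)) = 1"
    proof -
      have "(LINT y|lebesgue. \<rho> (x - y)) = (LINT y|lborel. \<rho> (x + - 1 *\<^sub>R y))"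
        by (subst integral_completion) auto
      also have "\<dots> = (LINT y|distr lborel borel (\<lambda>y. x + - 1 *\<^sub>R y). \<rho> y)"
        by (rule integral_distr[symmetric]) auto
      also have "\<dots> = 1"
        by (simp only: lborel_distr_reflect[of "- 1"] abs_minus_cancel abs_one \<rho>)
      finally show ?thesis .
    qed
    have const: "(\<lambda>y. c) \<in> L1_loc" for c :: real
      by (intro L2_loc_imp_L1_loc L2_loc_continuous continuous_intros)
    have g1: "g \<in> L1_loc"
      by (intro L2_loc_imp_L1_loc L2_loc_continuous g)
    have int: "integrable lebesgue (\<lambda>y. c * \<rho> (x - y))" for c
      by (rule integrable_conv[OF const \<rho>(1)])
    have "conv g \<rho> x - g x = (LINT y|lebesgue. g y * \<rho> (x - y) - g x * \<rho> (x - y))"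
      using int[of "g x"] integrable_conv[OF g1 \<rho>(1), of x] by (simp add: conv_def mass)
    also have "\<bar>\<dots>\<bar> \<le> (LINT y|lebesgue. \<epsilon> * \<rho> (x - y))"
      unfolding real_norm_def[symmetric]
    proof (rule Bochner_Integration.integral_norm_bound_integral)
      show "integrable lebesgue (\<lambda>y. g y * \<rho> (x - y) - g x * \<rho> (x - y))"
        using int[of "g x"] integrable_conv[OF g1 \<rho>(1), of x] by simp
      show "norm (g y * \<rho> (x - y) - g x * \<rho> (x - y)) \<le> \<epsilon> * \<rho> (x - y)" for y
      proof (cases "norm (x - y) < \<delta>")
        case True
        have "norm y \<le> norm x + norm (x - y)"
          using norm_triangle_ineq4[of x "x - y"] by simp
        then have "dist (g y) (g x) < \<epsilon>"
          using True \<delta> x by (intro d) (auto simp: dist_norm norm_minus_commute)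
        then show ?thesis
          using mult_right_mono[OF less_imp_le, of "\<bar>g y - g x\<bar>" \<epsilon> "\<rho> (x - y)"] \<rho>(2)[of "x - y"]
          by (simp add: dist_norm abs_mult flip: left_diff_distrib)
      qed (simp add: \<rho>)
    qed (rule int)
    also have "\<dots> = \<epsilon>"
      by (simp add: mass)
    finally show "\<bar>conv g \<rho> x - g x\<bar> \<le> \<epsilon>" .
  qed
qed

lemma add3_sq_le: "(a + b + c)\<^sup>2 \<le> 3 * a\<^sup>2 + 3 * b\<^sup>2 + 3 * (c::real)\<^sup>2"
  using zero_le_power2[of "a - b"] zero_le_power2[of "a - c"] zero_le_power2[of "b - c"]
  by (simp add: power2_eq_square algebra_simps)

text \<open>For a continuous \<open>g\<close> that is close to \<open>w\<close> in \<open>L\<^sup>2\<close>, the mollified functions converge uniformly on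
  balls, and by the contraction property mollification does not increase the error \<open>w - g\<close>.\<close>

lemma conv_tendsto_L2:
  fixes w :: "'a::euclidean_space \<Rightarrow> real"
  assumes w: "w \<in> L2_loc" and \<rho>: "\<And>n. is_mollifier (inverse (real (Suc n))) (\<rho> n)"
  shows "(\<lambda>n. LINT x:cball 0 r|lebesgue. (conv w (\<rho> n) x - w x)\<^sup>2) \<longlonglongrightarrow> 0"
proof (rule LIMSEQ_I)
  fix \<epsilon> :: real
  assume "\<epsilon> > 0"
  note w1 = L2_loc_imp_L1_loc[OF w]
  have test: "\<rho> n \<in> test_functions" for n
    using \<rho>[of n] by (simp add: is_mollifier_def)
  have cont: "continuous_on UNIV (conv u (\<rho> n))" if "u \<in> L1_loc" for u n
    by (intro smooth_continuous smooth_conv that test)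
  define V where "V = (LINT x:cball (0::'a) r|lebesgue. 1::real)"
  have V: "V \<ge> 0"
    unfolding V_def set_lebesgue_integral_def by (rule Bochner_Integration.integral_nonneg) simp
  \<comment> \<open>Three squared errors enter with the factor 3 of \<open>add3_sq_le\<close> and may contribute \<open>\<epsilon> / 4\<close> each; hence
    \<open>12 = 3 * 4\<close>.\<close>
  obtain g where g: "continuous_on UNIV g"
    and g_approx: "(LINT x:cball 0 (r + 1)|lebesgue. (w x - g x)\<^sup>2) < \<epsilon> / 12"
    using L2_loc_approx_continuous[OF w, of "\<epsilon> / 12" "r + 1"] \<open>\<epsilon> > 0\<close> by auto
  have g2: "g \<in> L2_loc"
    by (rule L2_loc_continuous[OF g])
  have wg: "(\<lambda>x. w x - g x) \<in> L2_loc"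
    by (intro L2_loc_diff w g2)
  define \<eta> where "\<eta> = sqrt (\<epsilon> / (12 * (V + 1)))"
  have \<eta>: "\<eta> > 0" "\<eta>\<^sup>2 = \<epsilon> / (12 * (V + 1))"
    using \<open>\<epsilon> > 0\<close> V by (auto simp: \<eta>_def)
  obtain d where "d > 0" and d: "\<And>\<delta> \<rho> x. is_mollifier \<delta> \<rho> \<Longrightarrow> \<delta> < d \<Longrightarrow> x \<in> cball 0 r \<Longrightarrow> \<bar>conv g \<rho> x - g x\<bar> \<le> \<eta>"
    using conv_continuous_approx[OF g \<eta>(1), of r] by metis
  obtain n0 where n0: "inverse (real (Suc n0)) < d"
    using reals_Archimedean[OF \<open>d > 0\<close>] by blast
  have "norm ((LINT x:cball 0 r|lebesgue. (conv w (\<rho> n) x - w x)\<^sup>2) - 0) < \<epsilon>" if "n \<ge> n0" for n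
  proof -
    have "inverse (real (Suc n)) \<le> inverse (real (Suc n0))"
      using that by (intro le_imp_inverse_le) auto
    then have close: "\<bar>conv g (\<rho> n) x - g x\<bar> \<le> \<eta>" if "x \<in> cball 0 r" for x
      using d[OF \<rho>[of n] _ that] n0 by linarith
    have split: "conv w (\<rho> n) x - w x
        = conv (\<lambda>x. w x - g x) (\<rho> n) x + (conv g (\<rho> n) x - g x) + (g x - w x)" for x
      using integrable_conv[OF w1 test, of n x] integrable_conv[OF L2_loc_imp_L1_loc[OF g2] test, of n x]
      by (simp add: conv_def left_diff_distrib)
    have i1: "set_integrable lebesgue (cball 0 r) (\<lambda>x. (conv (\<lambda>x. w x - g x) (\<rho> n) x)\<^sup>2)"
      by (intro L2_loc_real_integrable_sq L2_loc_continuous cont L2_loc_imp_L1_loc wg)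
    have i2: "set_integrable lebesgue (cball 0 r) (\<lambda>x. (g x - w x)\<^sup>2)" for r
      by (intro L2_loc_real_integrable_sq L2_loc_diff w g2)
    have i3: "set_integrable lebesgue (cball (0::'a) r) (\<lambda>x. \<eta>\<^sup>2)"
      by (rule set_integrable_const_compact) simp
    have i4: "set_integrable lebesgue (cball 0 r) (\<lambda>x. (conv w (\<rho> n) x - w x)\<^sup>2)"
      by (intro L2_loc_real_integrable_sq L2_loc_diff L2_loc_continuous cont w1 w)
    note j1 = set_integrable_mult_right[OF i1, of 3] and j2 = set_integrable_mult_right[OF i3, of 3]
      and j3 = set_integrable_mult_right[OF i2[of r], of 3]
    have "(LINT x:cball 0 r|lebesgue. (conv w (\<rho> n) x - w x)\<^sup>2)
      \<le> (LINT x:cball 0 r|lebesgue. 3 * (conv (\<lambda>x. w x - g x) (\<rho> n) x)\<^sup>2 + 3 * \<eta>\<^sup>2 + 3 * (g x - w x)\<^sup>2)"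
    proof (rule set_integral_mono[OF i4])
      show "set_integrable lebesgue (cball 0 r)
          (\<lambda>x. 3 * (conv (\<lambda>x. w x - g x) (\<rho> n) x)\<^sup>2 + 3 * \<eta>\<^sup>2 + 3 * (g x - w x)\<^sup>2)"
        by (intro set_integral_add(1) j1 j2 j3)
      fix x :: 'a
      assume "x \<in> cball 0 r"
      then have "(conv g (\<rho> n) x - g x)\<^sup>2 \<le> \<eta>\<^sup>2"
        using close \<eta>(1) by (simp flip: abs_le_square_iff)
      then show "(conv w (\<rho> n) x - w x)\<^sup>2
          \<le> 3 * (conv (\<lambda>x. w x - g x) (\<rho> n) x)\<^sup>2 + 3 * \<eta>\<^sup>2 + 3 * (g x - w x)\<^sup>2"
        unfolding split by (intro order_trans[OF add3_sq_le]) simp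
    qed
    also have "\<dots> = 3 * (LINT x:cball 0 r|lebesgue. (conv (\<lambda>x. w x - g x) (\<rho> n) x)\<^sup>2)
        + 3 * (LINT x:cball (0::'a) r|lebesgue. \<eta>\<^sup>2) + 3 * (LINT x:cball 0 r|lebesgue. (g x - w x)\<^sup>2)"
      by (simp only: set_integral_add(2)[OF set_integral_add(1)[OF j1 j2] j3]
          set_integral_add(2)[OF j1 j2] set_integral_mult_right)
    also have "(LINT x:cball (0::'a) r|lebesgue. \<eta>\<^sup>2) = V * \<eta>\<^sup>2"
      unfolding V_def by (subst set_integral_mult_left[symmetric]) simp
    also have "(LINT x:cball 0 r|lebesgue. (conv (\<lambda>x. w x - g x) (\<rho> n) x)\<^sup>2)
        \<le> (LINT x:cball 0 (r + 1)|lebesgue. (w x - g x)\<^sup>2)"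
      by (rule conv_L2_bound[OF wg \<rho>]) (simp add: inverse_le_1_iff)
    also have "(LINT x:cball 0 r|lebesgue. (g x - w x)\<^sup>2) \<le> (LINT x:cball 0 (r + 1)|lebesgue. (w x - g x)\<^sup>2)"
      unfolding power2_commute[of "w _"] using i2[of "r + 1"]
      unfolding set_lebesgue_integral_def set_integrable_def
      by (intro Bochner_Integration.integral_mono i2[unfolded set_integrable_def]) (auto simp: indicator_def)
    also have "V * \<eta>\<^sup>2 \<le> \<epsilon> / 12"
      using V \<open>\<epsilon> > 0\<close> unfolding \<eta>(2) by (simp add: field_simps)
    finally have "(LINT x:cball 0 r|lebesgue. (conv w (\<rho> n) x - w x)\<^sup>2) < \<epsilon>"
      using g_approx \<open>\<epsilon> > 0\<close> by simp
    moreover have "(LINT x:cball 0 r|lebesgue. (conv w (\<rho> n) x - w x)\<^sup>2) \<ge> 0"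
      unfolding set_lebesgue_integral_def by (rule Bochner_Integration.integral_nonneg) simp
    ultimately show ?thesis by simp
  qed
  then show "\<exists>no. \<forall>n\<ge>no. norm ((LINT x:cball 0 r|lebesgue. (conv w (\<rho> n) x - w x)\<^sup>2) - 0) < \<epsilon>"
    by blast
qed

section \<open>Smooth approximation and vanishing weak gradients\<close>

text \<open>Mollification commutes with weak gradients, so both convergence statements are instances of
  the convergence in \<open>L\<^sup>2\<close>. The last conclusion is an exact identity and not a limit; it turns the
  approximating functions into constants when the weak gradient vanishes.\<close>

lemma smooth_approximation:
  fixes u :: "'a::euclidean_space \<Rightarrow> real"
  assumes u: "u \<in> L2_loc" and G: "G \<in> L2_loc" and weak: "has_weak_gradient u G"
  obtains U :: "nat \<Rightarrow> 'a \<Rightarrow> real"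
  where "\<And>n. smooth (U n)"
    and "\<And>r. (\<lambda>n. LINT x:cball 0 r|lebesgue. (U n x - u x)\<^sup>2) \<longlonglongrightarrow> 0"
    and "\<And>r. (\<lambda>n. LINT x:cball 0 r|lebesgue. (norm (grad (U n) x - G x))\<^sup>2) \<longlonglongrightarrow> 0"
    and "\<And>n x. AE x in lebesgue. G x = 0 \<Longrightarrow> grad (U n) x = 0"
proof -
  have "\<forall>n. \<exists>\<rho> :: 'a \<Rightarrow> real. is_mollifier (inverse (real (Suc n))) \<rho>"
    by (intro allI ex_mollifier) simp
  then obtain \<rho> :: "nat \<Rightarrow> 'a \<Rightarrow> real" where \<rho>: "\<And>n. is_mollifier (inverse (real (Suc n))) (\<rho> n)"
    by metis
  then have test: "\<rho> n \<in> test_functions" for n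
    by (simp add: is_mollifier_def)
  show thesis
  proof
    show sm: "smooth (conv u (\<rho> n))" for n
      by (intro smooth_conv L2_loc_imp_L1_loc u test)
    show "(\<lambda>n. LINT x:cball 0 r|lebesgue. (conv u (\<rho> n) x - u x)\<^sup>2) \<longlonglongrightarrow> 0" for r
      by (rule conv_tendsto_L2[OF u \<rho>])
    show "(\<lambda>n. LINT x:cball 0 r|lebesgue. (norm (grad (conv u (\<rho> n)) x - G x))\<^sup>2) \<longlonglongrightarrow> 0" for r
    proof -
      have int: "set_integrable lebesgue (cball 0 r) (\<lambda>x. (conv (\<lambda>y. G y \<bullet> b) (\<rho> n) x - G x \<bullet> b)\<^sup>2)" for n b
        by (intro L2_loc_real_integrable_sq L2_loc_diff L2_loc_continuous smooth_continuous smooth_conv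
            L2_loc_imp_L1_loc L2_loc_inner G test)
      have "(norm (grad (conv u (\<rho> n)) x - G x))\<^sup>2
          = (\<Sum>b\<in>Basis. (conv (\<lambda>y. G y \<bullet> b) (\<rho> n) x - G x \<bullet> b)\<^sup>2)" for n x
        unfolding power2_norm_eq_inner
        by (subst euclidean_inner)
          (simp add: inner_diff_left grad_conv[OF weak test] flip: power2_eq_square)
      then have "(LINT x:cball 0 r|lebesgue. (norm (grad (conv u (\<rho> n)) x - G x))\<^sup>2)
          = (\<Sum>b\<in>Basis. LINT x:cball 0 r|lebesgue. (conv (\<lambda>y. G y \<bullet> b) (\<rho> n) x - G x \<bullet> b)\<^sup>2)" for n
        using int[unfolded set_integrable_def]
        by (simp only: set_lebesgue_integral_def scaleR_sum_right) (rule Bochner_Integration.integral_sum)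
      then show ?thesis
        using tendsto_null_sum[OF conv_tendsto_L2[OF L2_loc_inner[OF G] \<rho>]] by simp
    qed
    show "grad (conv u (\<rho> n)) x = 0" if "AE x in lebesgue. G x = 0" for n x
    proof (rule euclidean_eqI)
      fix b :: 'a
      have "conv (\<lambda>y. G y \<bullet> b) (\<rho> n) x = (LINT (y::'a)|lebesgue. 0)"
        unfolding conv_def
      proof (rule integral_cong_AE)
        show "(\<lambda>y. (G y \<bullet> b) * \<rho> n (x - y)) \<in> borel_measurable lebesgue"
          using integrable_conv[OF L2_loc_imp_L1_loc[OF L2_loc_inner[OF G]] test] by blast
      qed (use that in \<open>auto elim: eventually_mono\<close>)
      then show "grad (conv u (\<rho> n)) x \<bullet> b = 0 \<bullet> b"
        by (simp add: grad_conv[OF weak test])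
    qed
  qed
qed

lemma AE_imp_ex_cball:
  fixes P :: "'a::euclidean_space \<Rightarrow> bool"
  assumes "AE x in lebesgue. P x" and "r > 0"
  shows "\<exists>x\<in>cball 0 r. P x"
proof (rule ccontr)
  assume "\<not> (\<exists>x\<in>cball 0 r. P x)"
  then have "AE x in lebesgue. x \<notin> ball (0::'a) r"
    using assms(1) by (auto elim!: eventually_mono)
  then have "ball (0::'a) r \<in> null_sets lebesgue"
    by (simp add: AE_iff_null_sets)
  then show False
    using assms(2) open_not_negligible[of "ball (0::'a) r"] by (simp add: negligible_iff_null_sets)
qed

lemma L2_tendsto_imp_AE_subseq:
  fixes u :: "'a::euclidean_space \<Rightarrow> real"
  assumes u: "u \<in> L2_loc" and U: "\<And>n. U n \<in> L2_loc"
    and lim: "(\<lambda>n. LINT x:cball 0 r|lebesgue. (U n x - u x)\<^sup>2) \<longlonglongrightarrow> 0"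
  obtains s :: "nat \<Rightarrow> nat" where "strict_mono s"
    "AE x in lebesgue. x \<in> cball 0 r \<longrightarrow> (\<lambda>n. U (s n) x) \<longlonglongrightarrow> u x"
proof -
  define q where "q n x = indicator (cball 0 r) x *\<^sub>R (U n x - u x)\<^sup>2" for n x
  have "integrable lebesgue (q n)" for n
    using L2_loc_real_integrable_sq[OF L2_loc_diff[OF U u]]
    unfolding q_def[abs_def] set_integrable_def by blast
  moreover have "(\<lambda>n. LINT x|lebesgue. norm (q n x)) \<longlonglongrightarrow> 0"
    using lim by (simp add: q_def set_lebesgue_integral_def)
  ultimately have "\<exists>s :: nat \<Rightarrow> nat. strict_mono s \<and> (AE x in lebesgue. (\<lambda>n. q (s n) x) \<longlonglongrightarrow> 0)"
    by (rule tendsto_L1_AE_subseq)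
  then obtain s :: "nat \<Rightarrow> nat" where s: "strict_mono s"
    and ae: "AE x in lebesgue. (\<lambda>n. q (s n) x) \<longlonglongrightarrow> 0"
    by blast
  show thesis
  proof (rule that[OF s])
    show "AE x in lebesgue. x \<in> cball 0 r \<longrightarrow> (\<lambda>n. U (s n) x) \<longlonglongrightarrow> u x"
      using ae
    proof eventually_elim
      fix x
      assume l: "(\<lambda>n. q (s n) x) \<longlonglongrightarrow> 0"
      show "x \<in> cball 0 r \<longrightarrow> (\<lambda>n. U (s n) x) \<longlonglongrightarrow> u x"
      proof
        assume "x \<in> cball 0 r"
        then have "(\<lambda>n. (U (s n) x - u x)\<^sup>2) \<longlonglongrightarrow> 0"
          using l by (simp add: q_def)
        from tendsto_real_sqrt[OF this] have "(\<lambda>n. U (s n) x - u x) \<longlonglongrightarrow> 0"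
          by (simp add: tendsto_rabs_zero_iff)
        then show "(\<lambda>n. U (s n) x) \<longlonglongrightarrow> u x"
          by (simp add: LIM_zero_iff)
      qed
    qed
  qed
qed

lemma smooth_imp_L2_loc: "smooth w \<Longrightarrow> w \<in> L2_loc"
  by (intro L2_loc_continuous smooth_continuous)

text \<open>If the weak gradient vanishes, then the mollified functions have zero gradient and are
  constants; a pointwise limit of constants is constant.\<close>

lemma weak_gradient_zero_imp_const:
  fixes u :: "'a::euclidean_space \<Rightarrow> real"
  assumes u: "u \<in> L2_loc" and G: "G \<in> L2_loc" and weak: "has_weak_gradient u G"
    and zero: "AE x in lebesgue. G x = 0"
  shows "\<exists>c. AE x in lebesgue. u x = c"
proof -
  obtain U :: "nat \<Rightarrow> 'a \<Rightarrow> real" where sm: "\<And>n. smooth (U n)"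
    and lim: "\<And>r. (\<lambda>n. LINT x:cball 0 r|lebesgue. (U n x - u x)\<^sup>2) \<longlonglongrightarrow> 0"
    and "\<And>n x. AE x in lebesgue. G x = 0 \<Longrightarrow> grad (U n) x = 0"
    by (rule smooth_approximation[OF u G weak]) (rule that; assumption)
  from this(3)[OF zero] have grad_0: "grad (U n) x = 0" for n x .
  have "\<exists>c. \<forall>x\<in>UNIV. U n x = c" for n
  proof (rule has_derivative_zero_constant)
    show "(U n has_derivative (\<lambda>h. 0)) (at x within UNIV)" for x
      using smooth_has_derivative[OF sm, of n x] by (simp add: grad_0)
  qed simp
  then obtain c where c: "\<And>n x. U n x = c n"
    by (metis UNIV_I)
  have "\<exists>a. AE x in lebesgue. x \<in> cball 0 (real (Suc k)) \<longrightarrow> u x = a" for k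
  proof -
    obtain s :: "nat \<Rightarrow> nat" where
      ae: "AE x in lebesgue. x \<in> cball 0 (real (Suc k)) \<longrightarrow> (\<lambda>n. U (s n) x) \<longlonglongrightarrow> u x"
      using L2_tendsto_imp_AE_subseq[OF u smooth_imp_L2_loc[OF sm] lim] by metis
    obtain y where "(\<lambda>n. U (s n) y) \<longlonglongrightarrow> u y"
      using AE_imp_ex_cball[OF ae, of "real (Suc k)"] by auto
    then have "AE x in lebesgue. x \<in> cball 0 (real (Suc k)) \<longrightarrow> u x = u y"
      using ae unfolding c by (auto elim!: eventually_mono intro: LIMSEQ_unique)
    then show ?thesis ..
  qed
  then obtain a where a: "\<And>k. AE x in lebesgue. x \<in> cball 0 (real (Suc k)) \<longrightarrow> u x = a k"
    by metis
  have a_eq: "a k = a 0" for k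
  proof -
    have "AE x in lebesgue. (x \<in> cball 0 (real (Suc k)) \<longrightarrow> u x = a k) \<and> (x \<in> cball 0 (real (Suc 0)) \<longrightarrow> u x = a 0)"
      using a[of k] a[of 0] by (rule AE_conjI)
    from AE_imp_ex_cball[OF this, of 1] obtain y :: 'a where "norm y \<le> 1"
      "norm y \<le> real (Suc k) \<longrightarrow> u y = a k" "norm y \<le> real (Suc 0) \<longrightarrow> u y = a 0"
      by auto
    then show ?thesis
      by simp
  qed
  have "AE x in lebesgue. \<forall>k. x \<in> cball 0 (real (Suc k)) \<longrightarrow> u x = a k"
    using a by (simp add: AE_all_countable)
  then have "AE x in lebesgue. u x = a 0"
  proof eventually_elim
    fix x :: 'a
    assume *: "\<forall>k. x \<in> cball 0 (real (Suc k)) \<longrightarrow> u x = a k"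
    obtain k where "norm x \<le> real k"
      using real_arch_simple by blast
    then show "u x = a 0"
      using *[rule_format, of k] a_eq[of k] by simp
  qed
  then show ?thesis ..
qed

section \<open>Bounded functions of a Sobolev function as test functions\<close>

lemma L2_pairing_tendsto_0:
  fixes p :: "'a::euclidean_space \<Rightarrow> real"
  assumes p: "p \<in> L2_loc" and q: "\<And>n. q n \<in> L2_loc"
    and lim: "(\<lambda>n. LINT x:cball 0 r|lebesgue. (q n x)\<^sup>2) \<longlonglongrightarrow> 0"
  shows "(\<lambda>n. LINT x:cball 0 r|lebesgue. \<bar>p x * q n x\<bar>) \<longlonglongrightarrow> 0"
proof -
  define P where "P = (LINT x:cball 0 r|lebesgue. (p x)\<^sup>2)"
  define Q where "Q n = (LINT x:cball 0 r|lebesgue. (q n x)\<^sup>2)" for n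
  have Q_nonneg: "Q n \<ge> 0" for n
    unfolding Q_def set_lebesgue_integral_def by (rule Bochner_Integration.integral_nonneg) simp
  \<comment> \<open>With this weight the integrals of both terms of \<open>2 \<bar>p q\<bar> \<le> t p\<^sup>2 + q\<^sup>2 / t\<close> tend to 0; the summand
    \<open>1 / (n + 1)\<close> only keeps it positive.\<close>
  define t where "t n = sqrt (Q n) + inverse (real (Suc n))" for n
  have t_pos: "t n > 0" for n
    using Q_nonneg[of n] by (simp add: t_def add_nonneg_pos)
  have le: "(LINT x:cball 0 r|lebesgue. \<bar>p x * q n x\<bar>) \<le> t n * P + sqrt (Q n)" for n
  proof -
    have ip: "set_integrable lebesgue (cball 0 r) (\<lambda>x. t n * (p x)\<^sup>2)"
      and iq: "set_integrable lebesgue (cball 0 r) (\<lambda>x. (q n x)\<^sup>2 / t n)"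
      by (intro set_integrable_mult_right set_integrable_divide L2_loc_real_integrable_sq p q)+
    have "(LINT x:cball 0 r|lebesgue. \<bar>p x * q n x\<bar>)
        \<le> (LINT x:cball 0 r|lebesgue. t n * (p x)\<^sup>2 + (q n x)\<^sup>2 / t n)"
    proof (rule set_integral_mono)
      show "set_integrable lebesgue (cball 0 r) (\<lambda>x. \<bar>p x * q n x\<bar>)"
        by (rule set_integrable_abs) (intro set_integrable_L2_mult p q)
      show "\<bar>p x * q n x\<bar> \<le> t n * (p x)\<^sup>2 + (q n x)\<^sup>2 / t n" for x
      proof -
        have "2 * \<bar>p x * q n x\<bar> \<le> t n * (p x)\<^sup>2 + (q n x)\<^sup>2 / t n"
          using sum_squares_bound[of "sqrt (t n) * \<bar>p x\<bar>" "\<bar>q n x\<bar> / sqrt (t n)"] t_pos[of n]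
          by (simp add: power_mult_distrib power_divide abs_mult mult.assoc)
        then show ?thesis
          using abs_ge_zero[of "p x * q n x"] by linarith
      qed
    qed (intro set_integral_add ip iq)
    also have "\<dots> = t n * P + Q n / t n"
      using ip iq by (simp add: P_def Q_def)
    also have "Q n / t n \<le> sqrt (Q n)"
    proof -
      have "Q n = sqrt (Q n) * sqrt (Q n)"
        using Q_nonneg by simp
      also have "\<dots> \<le> sqrt (Q n) * t n"
        using Q_nonneg by (intro mult_left_mono) (auto simp: t_def)
      finally show ?thesis
        using t_pos[of n] by (simp add: divide_le_eq)
    qed
    finally show ?thesis by simp
  qed
  have Q: "(\<lambda>n. sqrt (Q n)) \<longlonglongrightarrow> 0"
    using tendsto_real_sqrt[OF lim] by (simp add: Q_def)
  then have "t \<longlonglongrightarrow> 0 + 0"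
    unfolding t_def by (intro tendsto_add LIMSEQ_inverse_real_of_nat)
  then have bound: "(\<lambda>n. t n * P + sqrt (Q n)) \<longlonglongrightarrow> 0"
    using tendsto_add[OF tendsto_mult_left_zero Q, of t P] by simp
  show ?thesis
  proof (rule tendsto_sandwich[OF _ _ tendsto_const bound])
    show "\<forall>\<^sub>F n in sequentially. 0 \<le> (LINT x:cball 0 r|lebesgue. \<bar>p x * q n x\<bar>)"
      unfolding set_lebesgue_integral_def
      by (intro always_eventually allI Bochner_Integration.integral_nonneg) simp
  qed (use le in auto)
qed

text \<open>The zero-order terms are only locally integrable, so the equation may be tested with bounded
  functions only. For smooth bounded \<open>T\<close> the function \<open>T (u\<^sub>n) \<theta>\<close>, with \<open>u\<^sub>n\<close> the mollified \<open>u\<close>, is a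
  test function; the passage to the limit needs \<open>\<nabla>u\<^sub>n \<rightarrow> \<nabla>u\<close> in \<open>L\<^sup>2\<close> on the support of \<open>\<theta>\<close>, and
  dominated convergence for everything else.\<close>

lemma test_with_bounded_function:
  fixes u Z T' :: "_ \<Rightarrow> real" and A G :: "'a::euclidean_space \<Rightarrow> 'a"
  assumes A: "A \<in> L2_loc" and Z: "Z \<in> L1_loc"
    and eq: "\<And>\<psi>. \<psi> \<in> test_functions \<Longrightarrow>
      (LINT x|lebesgue. A x \<bullet> grad \<psi> x) = (LINT x|lebesgue. Z x * \<psi> x)"
    and u: "u \<in> L2_loc" and G: "G \<in> L2_loc" and weak: "has_weak_gradient u G"
    and \<theta>: "\<theta> \<in> test_functions"
    and smooth_T: "smooth T" and T': "\<And>s. (T has_real_derivative T' s) (at s)"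
    and T'_cont: "continuous_on UNIV T'"
    and bound: "\<And>s. \<bar>T s\<bar> \<le> B" "\<And>s. \<bar>T' s\<bar> \<le> B"
  shows "(LINT x|lebesgue. T' (u x) * \<theta> x * (A x \<bullet> G x) + T (u x) * (A x \<bullet> grad \<theta> x))
    = (LINT x|lebesgue. Z x * (T (u x) * \<theta> x))"
proof -
  have sm_\<theta>: "smooth \<theta>"
    by (rule test_function_smooth[OF \<theta>])
  obtain r where r: "\<And>x. norm x > r \<Longrightarrow> \<theta> x = 0" "\<And>x. norm x > r \<Longrightarrow> grad \<theta> x = 0"
    using test_function_support[OF \<theta>] by metis
  obtain M where M: "\<And>x. \<bar>\<theta> x\<bar> \<le> M"
    using continuous_compact_support_bounded[OF smooth_continuous[OF sm_\<theta>] r(1)]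
    by (metis real_norm_def)
  have M_nonneg: "M \<ge> 0" and B_nonneg: "B \<ge> 0"
    using M[of 0] bound(1)[of 0] by linarith+
  obtain L where L: "\<And>x. norm (grad \<theta> x) \<le> L"
    using test_function_grad_bounded[OF \<theta>] by metis
  obtain U :: "nat \<Rightarrow> 'a \<Rightarrow> real" where sm_U: "\<And>n. smooth (U n)"
    and lim_U: "\<And>r. (\<lambda>n. LINT x:cball 0 r|lebesgue. (U n x - u x)\<^sup>2) \<longlonglongrightarrow> 0"
    and lim_grad_U: "\<And>r. (\<lambda>n. LINT x:cball 0 r|lebesgue. (norm (grad (U n) x - G x))\<^sup>2) \<longlonglongrightarrow> 0"
    by (rule smooth_approximation[OF u G weak]) (rule that; assumption)
  obtain s :: "nat \<Rightarrow> nat" where s: "strict_mono s"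
    and ae: "AE x in lebesgue. x \<in> cball 0 r \<longrightarrow> (\<lambda>n. U (s n) x) \<longlonglongrightarrow> u x"
    by (rule L2_tendsto_imp_AE_subseq[OF u smooth_imp_L2_loc[OF sm_U] lim_U]) (rule that; assumption)
  define V where "V n = U (s n)" for n
  have sm_V: "smooth (V n)" for n
    unfolding V_def by (rule sm_U)
  have T_cont: "continuous_on UNIV T"
    by (rule smooth_continuous[OF smooth_T])
  have ae_T: "AE x in lebesgue. x \<in> cball 0 r \<longrightarrow>
      (\<lambda>n. T (V n x)) \<longlonglongrightarrow> T (u x) \<and> (\<lambda>n. T' (V n x)) \<longlonglongrightarrow> T' (u x)"
    using ae by eventually_elim
      (auto simp: V_def intro: continuous_on_tendsto_compose[OF T_cont] continuous_on_tendsto_compose[OF T'_cont])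
  have [measurable]: "A \<in> borel_measurable lebesgue" "G \<in> borel_measurable lebesgue"
    "u \<in> borel_measurable lebesgue"
    by (rule L2_locD A G u)+
  have [measurable]: "\<theta> \<in> borel_measurable lebesgue" "grad \<theta> \<in> borel_measurable lebesgue"
    "V n \<in> borel_measurable lebesgue" "grad (V n) \<in> borel_measurable lebesgue" for n
    by (intro measurable_lebesgue_if_continuous smooth_continuous smooth_continuous_grad sm_\<theta> sm_V)+
  have [measurable]: "T \<in> borel_measurable borel" "T' \<in> borel_measurable borel"
    using T_cont T'_cont by (auto intro: borel_measurable_continuous_onI)
  \<comment> \<open>The integrand \<open>A \<bullet> \<nabla>\<psi>\<^sub>n\<close> is split into \<open>a n\<close>, in which the gradient of the mollified function is
    replaced by its limit \<open>G\<close> and which converges pointwise, and the error \<open>b n\<close>, which is small by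
    the convergence of the gradients in \<open>L\<^sup>2\<close>.\<close>
  define a where "a n x = T' (V n x) * \<theta> x * (A x \<bullet> G x) + T (V n x) * (A x \<bullet> grad \<theta> x)" for n x
  define b where "b n x = T' (V n x) * \<theta> x * (A x \<bullet> (grad (V n) x - G x))" for n x
  define a0 where "a0 x = T' (u x) * \<theta> x * (A x \<bullet> G x) + T (u x) * (A x \<bullet> grad \<theta> x)" for x
  define w where "w x = B * M * (norm (A x) * norm (G x)) + B * (norm (A x) * L)" for x
  have [measurable]: "a n \<in> borel_measurable lebesgue" "b n \<in> borel_measurable lebesgue"
    "a0 \<in> borel_measurable lebesgue" for n
    unfolding a_def b_def a0_def by measurable
  have int_w: "set_integrable lebesgue (cball 0 r) w"
    unfolding w_def
    by (intro set_integral_add set_integrable_mult_right set_integrable_L2_mult L2_loc_norm A G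
        L2_loc_continuous continuous_intros)
  have a_le: "\<bar>a n x\<bar> \<le> w x" for n x
  proof -
    have "\<bar>a n x\<bar> \<le> \<bar>T' (V n x) * \<theta> x * (A x \<bullet> G x)\<bar> + \<bar>T (V n x) * (A x \<bullet> grad \<theta> x)\<bar>"
      unfolding a_def by (rule abs_triangle_ineq)
    also have "\<bar>T' (V n x) * \<theta> x * (A x \<bullet> G x)\<bar> \<le> B * M * (norm (A x) * norm (G x))"
      unfolding abs_mult
      by (intro mult_mono bound M Cauchy_Schwarz_ineq2 mult_nonneg_nonneg B_nonneg M_nonneg) auto
    also have "\<bar>T (V n x) * (A x \<bullet> grad \<theta> x)\<bar> \<le> B * (norm (A x) * L)"
      unfolding abs_mult
      by (intro mult_mono bound order_trans[OF Cauchy_Schwarz_ineq2] mult_left_mono L B_nonneg) auto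
    finally show ?thesis
      by (simp add: w_def)
  qed
  have lim_a: "(\<lambda>n. LINT x:cball 0 r|lebesgue. a n x) \<longlonglongrightarrow> (LINT x:cball 0 r|lebesgue. a0 x)"
  proof (rule set_dominated_convergence[OF int_w])
    show "AE x in lebesgue. x \<in> cball 0 r \<longrightarrow> (\<lambda>n. a n x) \<longlonglongrightarrow> a0 x"
      using ae_T by eventually_elim (auto simp: a_def a0_def intro!: tendsto_intros)
  qed (use a_le in auto)
  have int_a: "set_integrable lebesgue (cball 0 r) (a n)" for n
    by (rule set_integrable_dominated[OF int_w]) (use a_le in auto)
  have H: "(\<lambda>x. norm (grad (V n) x - G x)) \<in> L2_loc" for n
    by (intro L2_loc_norm L2_loc_diff G L2_loc_continuous smooth_continuous_grad sm_V)
  have int_AH: "set_integrable lebesgue (cball 0 r) (\<lambda>x. B * M * \<bar>norm (A x) * norm (grad (V n) x - G x)\<bar>)" for n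
    by (intro set_integrable_mult_right set_integrable_abs set_integrable_L2_mult L2_loc_norm[OF A] H)
  have b_le: "\<bar>b n x\<bar> \<le> B * M * \<bar>norm (A x) * norm (grad (V n) x - G x)\<bar>" for n x
    unfolding b_def abs_mult abs_norm_cancel
    by (intro mult_mono bound M Cauchy_Schwarz_ineq2 mult_nonneg_nonneg B_nonneg M_nonneg) auto
  have int_b: "set_integrable lebesgue (cball 0 r) (b n)" for n
    by (rule set_integrable_dominated[OF int_AH]) (use b_le in auto)
  have lim_b: "(\<lambda>n. LINT x:cball 0 r|lebesgue. b n x) \<longlonglongrightarrow> 0"
  proof (rule Lim_null_comparison)
    show "\<forall>\<^sub>F n in sequentially. norm (LINT x:cball 0 r|lebesgue. b n x)
        \<le> B * M * (LINT x:cball 0 r|lebesgue. \<bar>norm (A x) * norm (grad (V n) x - G x)\<bar>)"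
    proof (intro always_eventually allI)
      fix n
      have "norm (LINT x:cball 0 r|lebesgue. b n x)
          \<le> (LINT x:cball 0 r|lebesgue. B * M * \<bar>norm (A x) * norm (grad (V n) x - G x)\<bar>)"
        unfolding set_lebesgue_integral_def
      proof (rule Bochner_Integration.integral_norm_bound_integral)
        show "norm (indicat_real (cball 0 r) x *\<^sub>R b n x)
            \<le> indicat_real (cball 0 r) x *\<^sub>R (B * M * \<bar>norm (A x) * norm (grad (V n) x - G x)\<bar>)" for x
          using b_le[of n x] by (auto simp: indicator_def)
      qed (use int_b int_AH in \<open>auto simp: set_integrable_def\<close>)
      then show "norm (LINT x:cball 0 r|lebesgue. b n x)
          \<le> B * M * (LINT x:cball 0 r|lebesgue. \<bar>norm (A x) * norm (grad (V n) x - G x)\<bar>)"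
        by simp
    qed
    show "(\<lambda>n. B * M * (LINT x:cball 0 r|lebesgue. \<bar>norm (A x) * norm (grad (V n) x - G x)\<bar>)) \<longlonglongrightarrow> 0"
      by (intro tendsto_mult_right_zero L2_pairing_tendsto_0 L2_loc_norm[OF A] H)
        (use LIMSEQ_subseq_LIMSEQ[OF lim_grad_U s, of r] in \<open>simp add: o_def V_def\<close>)
  qed
  define \<psi> where "\<psi> n x = T (V n x) * \<theta> x" for n x
  have sm_TV: "smooth (\<lambda>x. T (V n x))" for n
    using smooth_T sm_V times_cont_diff_compose by blast
  have test_\<psi>: "\<psi> n \<in> test_functions" for n
    unfolding \<psi>_def by (rule test_function_mult[OF \<theta> sm_TV])
  have grad_TV: "grad (\<lambda>x. T (V n x)) x = T' (V n x) *\<^sub>R grad (V n) x" for n x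
  proof (rule grad_eqI)
    have "((\<lambda>x. T (V n x)) has_derivative (\<lambda>v. T' (V n x) * (v \<bullet> grad (V n) x))) (at x)"
      by (rule has_derivative_compose[OF smooth_has_derivative[OF sm_V]])
        (use T' in \<open>simp add: has_field_derivative_def\<close>)
    then show "((\<lambda>x. T (V n x)) has_derivative (\<lambda>v. v \<bullet> T' (V n x) *\<^sub>R grad (V n) x)) (at x)"
      by simp
  qed
  have grad_\<psi>: "A x \<bullet> grad (\<psi> n) x = a n x + b n x" for n x
    unfolding \<psi>_def a_def b_def
    by (subst grad_mult[OF sm_TV sm_\<theta>])
      (simp add: grad_TV inner_add_right inner_diff_right algebra_simps)
  have ab_0: "a n x + b n x = 0" and a0_0: "a0 x = 0" if "norm x > r" for n x
    using that by (simp_all add: a_def b_def a0_def r)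
  have "(LINT x|lebesgue. A x \<bullet> grad (\<psi> n) x)
      = (LINT x:cball 0 r|lebesgue. a n x) + (LINT x:cball 0 r|lebesgue. b n x)" for n
    unfolding grad_\<psi>
    using integral_eq_set_integral_cball[of r "\<lambda>x. a n x + b n x", OF ab_0] int_a int_b by simp
  then have "(\<lambda>n. LINT x|lebesgue. A x \<bullet> grad (\<psi> n) x) \<longlonglongrightarrow> (LINT x:cball 0 r|lebesgue. a0 x) + 0"
    using tendsto_add[OF lim_a lim_b] by simp
  also have "(LINT x:cball 0 r|lebesgue. a0 x) + 0 = (LINT x|lebesgue. a0 x)"
    using integral_eq_set_integral_cball[of r a0, OF a0_0] by simp
  finally have lim1: "(\<lambda>n. LINT x|lebesgue. Z x * \<psi> n x) \<longlonglongrightarrow> (LINT x|lebesgue. a0 x)"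
    unfolding eq[OF test_\<psi>] .
  have int_Z: "integrable lebesgue (\<lambda>x. indicator (cball 0 r) x *\<^sub>R Z x)"
    by (rule L1_loc_integrable_cball[OF Z])
  have [measurable]: "(\<lambda>x. indicator (cball 0 r) x *\<^sub>R Z x) \<in> borel_measurable lebesgue"
    using int_Z by blast
  have Z_eq: "Z x * (y * \<theta> x) = indicator (cball 0 r) x *\<^sub>R Z x * (y * \<theta> x)" for x y
    using r(1)[of x] by (cases "norm x > r") (auto simp: indicator_def)
  have lim2: "(\<lambda>n. LINT x|lebesgue. Z x * \<psi> n x) \<longlonglongrightarrow> (LINT x|lebesgue. Z x * (T (u x) * \<theta> x))"
    unfolding \<psi>_def Z_eq
  proof (rule integral_dominated_convergence)
    show "integrable lebesgue (\<lambda>x. \<bar>indicator (cball 0 r) x *\<^sub>R Z x\<bar> * (B * M))"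
      by (intro integrable_mult_left integrable_abs int_Z)
    show "AE x in lebesgue. (\<lambda>n. indicator (cball 0 r) x *\<^sub>R Z x * (T (V n x) * \<theta> x))
        \<longlonglongrightarrow> indicator (cball 0 r) x *\<^sub>R Z x * (T (u x) * \<theta> x)"
      using ae_T by eventually_elim (auto simp: indicator_def intro!: tendsto_intros)
    show "AE x in lebesgue. norm (indicator (cball 0 r) x *\<^sub>R Z x * (T (V n x) * \<theta> x))
        \<le> \<bar>indicator (cball 0 r) x *\<^sub>R Z x\<bar> * (B * M)" for n
      unfolding real_norm_def abs_mult[of "indicator (cball 0 r) _ *\<^sub>R Z _"] abs_mult[of "T _"]
      by (intro AE_I2 mult_left_mono mult_mono bound M B_nonneg abs_ge_zero)
  qed measurable
  show ?thesis
    using LIMSEQ_unique[OF lim1 lim2] by (simp add: a0_def)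
qed

section \<open>The energy inequality\<close>

text \<open>A smooth substitute for truncation at height \<open>k\<close>: bounded, odd, increasing, with slope in
  \<open>(0, 1]\<close>, and tending to the identity as \<open>k\<close> tends to infinity.\<close>

definition soft_truncation :: "real \<Rightarrow> real \<Rightarrow> real" where
  "soft_truncation k s = k * arctan (s / k)"

lemma smooth_soft_truncation: "smooth (soft_truncation k)"
proof -
  have "times_cont_diff n (\<lambda>s. inverse k * (s \<bullet> (1::real)))" for n
    by (intro times_cont_diff_mult times_cont_diff_const times_cont_diff_inner)
  then have "smooth (\<lambda>s. s / k)"
    by (simp add: divide_inverse mult.commute)
  from times_cont_diff_arctan[OF this] have "times_cont_diff n (\<lambda>s. arctan (s / k))" for n
    by blast
  then show ?thesis
    unfolding soft_truncation_def[abs_def] by (intro allI times_cont_diff_mult times_cont_diff_const)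
qed

lemma soft_truncation_has_derivative:
  assumes "k > 0"
  shows "(soft_truncation k has_real_derivative inverse (1 + (s / k)\<^sup>2)) (at s)"
  unfolding soft_truncation_def[abs_def]
  using DERIV_cmult[OF DERIV_chain2[OF DERIV_arctan DERIV_cdivide[OF DERIV_ident, where c=k]], where c=k]
    assms by simp

lemma abs_arctan_le_abs: "\<bar>arctan x\<bar> \<le> \<bar>x\<bar>"
proof -
  have "norm (arctan x - arctan 0) \<le> 1 * norm (x - 0)"
  proof (rule field_differentiable_bound[where S=UNIV and f'="\<lambda>y. inverse (1 + y\<^sup>2)"])
    show "norm (inverse (1 + y\<^sup>2)) \<le> 1" for y :: real
      by (simp add: inverse_le_1_iff)
  qed (auto intro: DERIV_arctan)
  then show ?thesis
    by simp
qed

lemma abs_soft_truncation_le: "k > 0 \<Longrightarrow> \<bar>soft_truncation k s\<bar> \<le> \<bar>s\<bar>"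
  using mult_left_mono[OF abs_arctan_le_abs, of k "s / k"]
  by (simp add: soft_truncation_def abs_mult)

lemma soft_truncation_bounded: "k > 0 \<Longrightarrow> \<bar>soft_truncation k s\<bar> \<le> k * 2"
  using arctan_bounded[of "s / k"] pi_less_4
  by (auto simp: soft_truncation_def abs_mult intro!: mult_left_mono)

lemma soft_truncation_tendsto: "(\<lambda>n. soft_truncation (real (Suc n)) s) \<longlonglongrightarrow> s"
proof (cases "s = 0")
  case False
  have D: "((\<lambda>h. arctan h / h) \<longlongrightarrow> 1) (at 0)"
    using DERIV_arctan[of 0] by (simp add: has_field_derivative_iff)
  have "(\<lambda>n. s * inverse (real (Suc n))) \<longlonglongrightarrow> 0"
    by (intro tendsto_mult_right_zero LIMSEQ_inverse_real_of_nat)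
  then have "filterlim (\<lambda>n. s * inverse (real (Suc n))) (at 0) sequentially"
    using False by (simp add: filterlim_at)
  from filterlim_compose[OF D this]
  have "(\<lambda>n. s * (arctan (s * inverse (real (Suc n))) / (s * inverse (real (Suc n))))) \<longlonglongrightarrow> s * 1"
    by (intro tendsto_mult tendsto_const)
  moreover have "s * (arctan (s * inverse (real (Suc n))) / (s * inverse (real (Suc n))))
      = soft_truncation (real (Suc n)) s" for n
    using False by (simp add: soft_truncation_def divide_inverse)
  ultimately show ?thesis
    by simp
qed (simp add: soft_truncation_def)

lemma mono_soft_truncation: "k > 0 \<Longrightarrow> mono (soft_truncation k)"
  by (intro monoI) (auto simp: soft_truncation_def arctan_le_iff divide_right_mono)

lemma soft_truncation_minus: "soft_truncation k (- s) = - soft_truncation k s"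
  by (simp add: soft_truncation_def arctan_minus)

text \<open>Symmetrising the double sum turns it into \<open>h\<^sub>i\<^sub>j f (s\<^sub>i - s\<^sub>j) (T s\<^sub>i - T s\<^sub>j) / 2\<close>, where the second and
  third factors have the same sign.\<close>

lemma coupling_sum_nonpos:
  fixes h :: "'i \<Rightarrow> 'i \<Rightarrow> real" and f g T :: "real \<Rightarrow> real"
  assumes h: "\<And>i j. i \<in> I \<Longrightarrow> j \<in> I \<Longrightarrow> h i j \<le> 0" "\<And>i j. i \<in> I \<Longrightarrow> j \<in> I \<Longrightarrow> h i j = h j i"
    and k: "\<And>i. i \<in> I \<Longrightarrow> k i \<le> 0"
    and f: "\<And>t. f (- t) = - f t" "\<And>t. t > 0 \<Longrightarrow> f t \<ge> 0"
    and g: "\<And>t. g (- t) = - g t" "\<And>t. t > 0 \<Longrightarrow> g t \<ge> 0"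
    and T: "mono T" "\<And>t. T (- t) = - T t"
  shows "(\<Sum>i\<in>I. ((\<Sum>j\<in>I. h i j * f (s i - s j)) + k i * g (s i)) * T (s i)) \<le> 0"
proof -
  have same_sign: "0 \<le> q (a - b) * (T a - T b)"
    if q: "\<And>t. q (- t) = - q t" "\<And>t. t > 0 \<Longrightarrow> q t \<ge> 0" for q :: "real \<Rightarrow> real" and a b
  proof -
    consider "a > b" | "a < b" | "a = b" by linarith
    then show ?thesis
    proof cases
      case 1
      then show ?thesis
        using q(2)[of "a - b"] monoD[OF T(1), of b a] by (intro mult_nonneg_nonneg) auto
    next
      case 2
      then show ?thesis
        using q(2)[of "b - a"] q(1)[of "b - a"] monoD[OF T(1), of a b]
        by (intro mult_nonpos_nonpos) auto
    qed simp
  qed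
  have T_0: "T 0 = 0"
    using T(2)[of 0] by simp
  define S where "S = (\<Sum>i\<in>I. \<Sum>j\<in>I. h i j * f (s i - s j) * T (s i))"
  have "S = (\<Sum>i\<in>I. \<Sum>j\<in>I. h j i * f (s j - s i) * T (s j))"
    unfolding S_def by (rule sum.swap)
  also have "\<dots> = - (\<Sum>i\<in>I. \<Sum>j\<in>I. h i j * f (s i - s j) * T (s j))"
  proof -
    have "h j i * f (s j - s i) * T (s j) = - (h i j * f (s i - s j) * T (s j))"
      if "i \<in> I" "j \<in> I" for i j
      using h(2)[OF that] f(1)[of "s i - s j"] by simp
    then show ?thesis
      by (simp add: sum_negf cong: sum.cong)
  qed
  finally have "2 * S = (\<Sum>i\<in>I. \<Sum>j\<in>I. h i j * (f (s i - s j) * (T (s i) - T (s j))))"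
    by (simp add: S_def right_diff_distrib sum_subtractf mult.assoc)
  also have "\<dots> \<le> 0"
    by (intro sum_nonpos mult_nonpos_nonneg h same_sign f)
  finally have "S \<le> 0" by simp
  moreover have "(\<Sum>i\<in>I. k i * (g (s i) * T (s i))) \<le> 0"
    using same_sign[of g "s _" 0] g by (intro sum_nonpos mult_nonpos_nonneg k) (auto simp: T_0)
  ultimately show ?thesis
    by (simp add: S_def distrib_right sum.distrib sum_distrib_right mult.assoc)
qed

text \<open>Testing with \<open>T\<^sub>n (\<sigma>\<^sub>i) \<theta>\<close> and summing makes the zero-order terms drop out by their sign; then the
  truncations \<open>T\<^sub>n\<close> are removed by dominated convergence.\<close>

lemma energy_inequality:
  fixes \<sigma> Z :: "'i \<Rightarrow> 'a::euclidean_space \<Rightarrow> real" and A G :: "'i \<Rightarrow> 'a \<Rightarrow> 'a"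
  assumes I: "finite I"
    and A: "\<And>i. i \<in> I \<Longrightarrow> A i \<in> L2_loc" and Z: "\<And>i. i \<in> I \<Longrightarrow> Z i \<in> L1_loc"
    and \<sigma>: "\<And>i. i \<in> I \<Longrightarrow> \<sigma> i \<in> L2_loc" and G: "\<And>i. i \<in> I \<Longrightarrow> G i \<in> L2_loc"
    and weak: "\<And>i. i \<in> I \<Longrightarrow> has_weak_gradient (\<sigma> i) (G i)"
    and eq: "\<And>i \<psi>. i \<in> I \<Longrightarrow> \<psi> \<in> test_functions \<Longrightarrow>
      (LINT x|lebesgue. A i x \<bullet> grad \<psi> x) = (LINT x|lebesgue. Z i x * \<psi> x)"
    and sign: "\<And>T. mono T \<Longrightarrow> (\<And>t. T (- t) = - T t) \<Longrightarrow>
      AE x in lebesgue. (\<Sum>i\<in>I. Z i x * T (\<sigma> i x)) \<le> 0"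
    and \<theta>: "\<theta> \<in> test_functions" "\<And>x. \<theta> x \<ge> 0"
  shows "(\<Sum>i\<in>I. LINT x|lebesgue. \<theta> x * (A i x \<bullet> G i x) + \<sigma> i x * (A i x \<bullet> grad \<theta> x)) \<le> 0"
proof -
  have sm_\<theta>: "smooth \<theta>"
    by (rule test_function_smooth[OF \<theta>(1)])
  obtain r where r: "\<And>x. norm x > r \<Longrightarrow> \<theta> x = 0" "\<And>x. norm x > r \<Longrightarrow> grad \<theta> x = 0"
    using test_function_support[OF \<theta>(1)] by metis
  obtain M where M: "\<And>x. \<bar>\<theta> x\<bar> \<le> M"
    using continuous_compact_support_bounded[OF smooth_continuous[OF sm_\<theta>] r(1)]
    by (metis real_norm_def)
  have M_nonneg: "M \<ge> 0"
    using M[of 0] by linarith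
  obtain L where L: "\<And>x. norm (grad \<theta> x) \<le> L"
    using test_function_grad_bounded[OF \<theta>(1)] by metis
  have [measurable]: "\<theta> \<in> borel_measurable lebesgue" "grad \<theta> \<in> borel_measurable lebesgue"
    by (intro measurable_lebesgue_if_continuous smooth_continuous smooth_continuous_grad sm_\<theta>)+
  define T where "T n = soft_truncation (real (Suc n))" for n
  define T' where "T' n s = inverse (1 + (s / real (Suc n))\<^sup>2)" for n s
  have T'_range: "0 \<le> T' n s" "T' n s \<le> 1" for n s
    unfolding T'_def by (auto intro!: inverse_le_1_iff[THEN iffD2])
  have T'_cont: "continuous_on UNIV (T' n)" for n
    unfolding T'_def by (intro continuous_intros) (auto simp: add_nonneg_eq_0_iff)
  have T_cont: "continuous_on UNIV (T n)" for n
    unfolding T_def by (rule smooth_continuous[OF smooth_soft_truncation])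
  have T'_lim: "(\<lambda>n. T' n s) \<longlonglongrightarrow> 1" for s
  proof -
    have "(\<lambda>n. s * inverse (real (Suc n))) \<longlonglongrightarrow> 0"
      by (intro tendsto_mult_right_zero LIMSEQ_inverse_real_of_nat)
    then have "(\<lambda>n. inverse (1 + (s * inverse (real (Suc n)))\<^sup>2)) \<longlonglongrightarrow> inverse (1 + 0\<^sup>2)"
      by (intro tendsto_intros) auto
    then show ?thesis
      by (simp add: T'_def divide_inverse)
  qed
  have T_lim: "(\<lambda>n. T n s) \<longlonglongrightarrow> s" for s
    unfolding T_def by (rule soft_truncation_tendsto)
  have T_le: "\<bar>T n s\<bar> \<le> \<bar>s\<bar>" for n s
    unfolding T_def by (rule abs_soft_truncation_le) simp
  have T_bound: "\<bar>T n s\<bar> \<le> real (Suc n) * 2" for n s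
    unfolding T_def by (rule soft_truncation_bounded) simp
  have [measurable]: "T n \<in> borel_measurable borel" "T' n \<in> borel_measurable borel" for n
    using T_cont T'_cont by (auto intro: borel_measurable_continuous_onI)
  define a where "a n i x = T' n (\<sigma> i x) * \<theta> x * (A i x \<bullet> G i x) + T n (\<sigma> i x) * (A i x \<bullet> grad \<theta> x)" for n i x
  define a0 where "a0 i x = \<theta> x * (A i x \<bullet> G i x) + \<sigma> i x * (A i x \<bullet> grad \<theta> x)" for i x
  have "(\<Sum>i\<in>I. LINT x|lebesgue. a n i x) \<le> 0" for n
  proof -
    have int: "integrable lebesgue (\<lambda>x. Z i x * (T n (\<sigma> i x) * \<theta> x))" if i: "i \<in> I" for i
    proof -
      have [measurable]: "\<sigma> i \<in> borel_measurable lebesgue"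
        by (rule L2_locD(1)[OF \<sigma>[OF i]])
      have "integrable lebesgue (\<lambda>x. Z i x *\<^sub>R (T n (\<sigma> i x) * \<theta> x))"
      proof (rule integrable_L1_loc_times_bounded[OF Z[OF i]])
        show "norm (T n (\<sigma> i x) * \<theta> x) \<le> real (Suc n) * 2 * M" for x
          unfolding real_norm_def abs_mult by (intro mult_mono T_bound M) auto
        show "T n (\<sigma> i x) * \<theta> x = 0" if "norm x > r" for x
          using r(1)[OF that] by simp
      qed measurable
      then show ?thesis by simp
    qed
    have "(LINT x|lebesgue. a n i x) = (LINT x|lebesgue. Z i x * (T n (\<sigma> i x) * \<theta> x))" if i: "i \<in> I" for i
      unfolding a_def
    proof (rule test_with_bounded_function[OF A[OF i] Z[OF i] eq[OF i] \<sigma>[OF i] G[OF i] weak[OF i] \<theta>(1)])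
      show "smooth (T n)"
        unfolding T_def by (rule smooth_soft_truncation)
      show "(T n has_real_derivative T' n s) (at s)" for s
        unfolding T_def T'_def by (rule soft_truncation_has_derivative) simp
      show "\<bar>T n s\<bar> \<le> real (Suc n) * 2" for s
        by (rule T_bound)
      show "\<bar>T' n s\<bar> \<le> real (Suc n) * 2" for s
        using T'_range[of n s] by simp
    qed (assumption | rule T'_cont)+
    then have "(\<Sum>i\<in>I. LINT x|lebesgue. a n i x)
        = (\<Sum>i\<in>I. LINT x|lebesgue. Z i x * (T n (\<sigma> i x) * \<theta> x))"
      by (rule sum.cong[OF refl])
    also have "\<dots> = (LINT x|lebesgue. (\<Sum>i\<in>I. Z i x * (T n (\<sigma> i x) * \<theta> x)))"
      by (rule Bochner_Integration.integral_sum[symmetric]) (rule int)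
    also have "\<dots> \<le> 0"
    proof (rule integral_nonpos_if_AE)
      have "AE x in lebesgue. (\<Sum>i\<in>I. Z i x * T n (\<sigma> i x)) \<le> 0"
        unfolding T_def by (rule sign) (auto intro: mono_soft_truncation soft_truncation_minus)
      then show "AE x in lebesgue. (\<Sum>i\<in>I. Z i x * (T n (\<sigma> i x) * \<theta> x)) \<le> 0"
      proof eventually_elim
        fix x
        assume "(\<Sum>i\<in>I. Z i x * T n (\<sigma> i x)) \<le> 0"
        then have "(\<Sum>i\<in>I. Z i x * T n (\<sigma> i x)) * \<theta> x \<le> 0"
          using \<theta>(2) by (rule mult_nonpos_nonneg)
        then show "(\<Sum>i\<in>I. Z i x * (T n (\<sigma> i x) * \<theta> x)) \<le> 0"
          by (simp add: sum_distrib_right mult.assoc)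
      qed
    qed
    finally show ?thesis .
  qed
  moreover have "(\<lambda>n. \<Sum>i\<in>I. LINT x|lebesgue. a n i x) \<longlonglongrightarrow> (\<Sum>i\<in>I. LINT x|lebesgue. a0 i x)"
  proof (rule tendsto_sum)
    fix i
    assume i: "i \<in> I"
    have [measurable]: "A i \<in> borel_measurable lebesgue" "G i \<in> borel_measurable lebesgue"
      "\<sigma> i \<in> borel_measurable lebesgue"
      by (intro L2_locD(1) A G \<sigma> i)+
    define w where "w x = M * (norm (A i x) * norm (G i x)) + L * (norm (\<sigma> i x) * norm (A i x))" for x
    have int_w: "set_integrable lebesgue (cball 0 r) w"
      unfolding w_def
      by (intro set_integral_add set_integrable_mult_right set_integrable_L2_mult L2_loc_norm A G \<sigma> i)
    have [measurable]: "a n i \<in> borel_measurable lebesgue" "a0 i \<in> borel_measurable lebesgue" for n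
      unfolding a_def a0_def by measurable
    have "(\<lambda>n. LINT x:cball 0 r|lebesgue. a n i x) \<longlonglongrightarrow> (LINT x:cball 0 r|lebesgue. a0 i x)"
    proof (rule set_dominated_convergence[OF int_w])
      have "(\<lambda>n. a n i x) \<longlonglongrightarrow> 1 * \<theta> x * (A i x \<bullet> G i x) + \<sigma> i x * (A i x \<bullet> grad \<theta> x)" for x
        unfolding a_def by (intro tendsto_intros T'_lim T_lim)
      then show "AE x in lebesgue. x \<in> cball 0 r \<longrightarrow> (\<lambda>n. a n i x) \<longlonglongrightarrow> a0 i x"
        by (simp add: a0_def)
      have "\<bar>a n i x\<bar> \<le> w x" for n x
      proof -
        have "\<bar>a n i x\<bar> \<le> \<bar>T' n (\<sigma> i x) * \<theta> x * (A i x \<bullet> G i x)\<bar> + \<bar>T n (\<sigma> i x) * (A i x \<bullet> grad \<theta> x)\<bar>"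
          unfolding a_def by (rule abs_triangle_ineq)
        also have "\<bar>T' n (\<sigma> i x) * \<theta> x * (A i x \<bullet> G i x)\<bar> \<le> 1 * M * (norm (A i x) * norm (G i x))"
          unfolding abs_mult using T'_range[of n "\<sigma> i x"]
          by (intro mult_mono M Cauchy_Schwarz_ineq2 mult_nonneg_nonneg M_nonneg) auto
        also have "\<bar>T n (\<sigma> i x) * (A i x \<bullet> grad \<theta> x)\<bar> \<le> \<bar>\<sigma> i x\<bar> * (norm (A i x) * L)"
          unfolding abs_mult
          by (intro mult_mono T_le order_trans[OF Cauchy_Schwarz_ineq2] mult_left_mono L) auto
        finally show ?thesis
          by (simp add: w_def mult.commute mult.left_commute)
      qed
      then show "AE x in lebesgue. x \<in> cball 0 r \<longrightarrow> \<bar>a n i x\<bar> \<le> w x" for n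
        by simp
    qed measurable
    moreover have "a n i x = 0" "a0 i x = 0" if "norm x > r" for n x
      using that by (simp_all add: a_def a0_def r)
    ultimately show "(\<lambda>n. LINT x|lebesgue. a n i x) \<longlonglongrightarrow> (LINT x|lebesgue. a0 i x)"
      using integral_eq_set_integral_cball[of r "a _ i"] integral_eq_set_integral_cball[of r "a0 i"] by simp
  qed
  ultimately show ?thesis
    unfolding a0_def by (intro LIMSEQ_le_const2[of "\<lambda>n. \<Sum>i\<in>I. LINT x|lebesgue. a n i x"]) auto
qed

section \<open>Vanishing of the energy\<close>

text \<open>With \<open>\<delta> = 1/2\<close> the hypothesis bounds the energy of all balls by \<open>4 C\<close>. Hence the energy of the
  dyadic annuli tends to 0, and the hypothesis for an arbitrary \<open>\<delta>\<close> bounds the total energy by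
  \<open>C / \<delta>\<close>.\<close>

lemma energy_vanishes:
  fixes e :: "'a::euclidean_space \<Rightarrow> real" and \<zeta> :: "real \<Rightarrow> 'a \<Rightarrow> real"
  assumes e: "e \<in> L1_loc" "\<And>x. e x \<ge> 0"
    and \<zeta>: "\<And>R. R > 0 \<Longrightarrow> \<zeta> R \<in> test_functions"
      "\<And>R x. 0 \<le> \<zeta> R x \<and> \<zeta> R x \<le> 1"
      "\<And>R x. R > 0 \<Longrightarrow> x \<in> ball 0 R \<Longrightarrow> \<zeta> R x = 1"
    and key: "\<And>R \<delta>. R > 1 \<Longrightarrow> \<delta> > 0 \<Longrightarrow>
      (LINT x|lebesgue. (\<zeta> R x)\<^sup>2 * e x)
        \<le> \<delta> * (LINT x:(ball 0 (2 * R) - ball 0 R)|lebesgue. (\<zeta> R x)\<^sup>2 * e x) + C / \<delta>"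
  shows "AE x in lebesgue. e x = 0"
proof -
  define J where "J R = (LINT x|lebesgue. (\<zeta> R x)\<^sup>2 * e x)" for R
  define E where "E R = (LINT x:ball 0 R|lebesgue. e x)" for R
  have int_J: "integrable lebesgue (\<lambda>x. (\<zeta> R x)\<^sup>2 * e x)" if "R > 0" for R
  proof -
    have "(\<lambda>x. \<zeta> R x * \<zeta> R x) \<in> test_functions"
      by (intro test_function_mult \<zeta> that test_function_smooth)
    from integrable_L1_loc_times_test[OF e(1) this] show ?thesis
      by (simp add: power2_eq_square mult.commute)
  qed
  have int_E: "set_integrable lebesgue (ball 0 R) e" for R
    by (rule L1_loc_set_integrable_subset_cball[OF e(1), of _ R]) auto
  have int_W: "set_integrable lebesgue (ball 0 (2 * R) - ball 0 R) e" for R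
    by (rule L1_loc_set_integrable_subset_cball[OF e(1), of _ "2 * R"]) auto
  have sq: "0 \<le> (\<zeta> R x)\<^sup>2 * e x" "(\<zeta> R x)\<^sup>2 * e x \<le> e x" for R x
    using e(2)[of x] \<zeta>(2)[of R x] by (auto intro: mult_left_le_one_le power_le_one)
  have int_\<zeta>W: "integrable lebesgue (\<lambda>x. indicator (ball 0 (2 * R) - ball 0 R) x *\<^sub>R ((\<zeta> R x)\<^sup>2 * e x))"
    if "R > 0" for R
    by (intro integrable_mult_indicator int_J that) auto
  have E_le_J: "E R \<le> J R" if "R > 0" for R
    unfolding E_def J_def set_lebesgue_integral_def
  proof (rule Bochner_Integration.integral_mono)
    show "indicator (ball 0 R) x *\<^sub>R e x \<le> (\<zeta> R x)\<^sup>2 * e x" for x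
      using \<zeta>(3)[OF that, of x] sq(1)[of R x] by (auto simp: indicator_def)
  qed (use int_E int_J that in \<open>auto simp: set_integrable_def\<close>)
  have W_le_J: "(LINT x:(ball 0 (2 * R) - ball 0 R)|lebesgue. (\<zeta> R x)\<^sup>2 * e x) \<le> J R" if "R > 0" for R
    unfolding J_def set_lebesgue_integral_def
    by (rule Bochner_Integration.integral_mono[OF int_\<zeta>W[OF that] int_J[OF that]])
      (use sq(1) in \<open>auto simp: indicator_def\<close>)
  have W_le_E: "(LINT x:(ball 0 (2 * R) - ball 0 R)|lebesgue. (\<zeta> R x)\<^sup>2 * e x) \<le> E (2 * R) - E R"
    if "R > 0" for R
  proof -
    have "(LINT x:(ball 0 (2 * R) - ball 0 R)|lebesgue. (\<zeta> R x)\<^sup>2 * e x)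
        \<le> (LINT x:(ball 0 (2 * R) - ball 0 R)|lebesgue. e x)"
      by (rule set_integral_mono) (use int_\<zeta>W[OF that] int_W sq(2) in \<open>auto simp: set_integrable_def\<close>)
    also have "\<dots> = (LINT x|lebesgue. indicator (ball 0 (2 * R)) x *\<^sub>R e x - indicator (ball 0 R) x *\<^sub>R e x)"
      unfolding set_lebesgue_integral_def
      by (rule Bochner_Integration.integral_cong) (use that in \<open>auto simp: indicator_def\<close>)
    also have "\<dots> = E (2 * R) - E R"
      using int_E by (simp add: E_def set_lebesgue_integral_def set_integrable_def)
    finally show ?thesis .
  qed
  have J_bound: "J R \<le> 4 * C" if "R > 1" for R
    using key[OF that, of "1 / 2"] W_le_J[of R] that by (simp add: J_def)
  define a where "a k = E (2 ^ Suc k)" for k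
  have "E R \<le> E R'" if "R \<le> R'" for R R'
    unfolding E_def set_lebesgue_integral_def
    by (rule Bochner_Integration.integral_mono)
      (use that int_E e(2) in \<open>auto simp: set_integrable_def indicator_def\<close>)
  then have "incseq a"
    unfolding a_def by (intro monoI) (simp add: power_increasing)
  have pow: "(2::real) ^ Suc k > 1" for k
    by (rule one_less_power) auto
  have "a k \<le> 4 * C" for k
    using E_le_J[of "2 ^ Suc k"] J_bound[OF pow[of k]] pow[of k] unfolding a_def by linarith
  then obtain l where l: "a \<longlonglongrightarrow> l" and le_l: "\<And>k. a k \<le> l"
    using incseq_convergent[OF \<open>incseq a\<close>] by blast
  have "l \<le> C / \<delta>" if "\<delta> > 0" for \<delta>
  proof (rule LIMSEQ_le[OF l])
    have "(\<lambda>k. \<delta> * (a (Suc k) - a k) + C / \<delta>) \<longlonglongrightarrow> \<delta> * (l - l) + C / \<delta>"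
      by (intro tendsto_intros l LIMSEQ_Suc)
    then show "(\<lambda>k. \<delta> * (a (Suc k) - a k) + C / \<delta>) \<longlonglongrightarrow> C / \<delta>"
      by simp
    have "a k \<le> \<delta> * (a (Suc k) - a k) + C / \<delta>" for k
    proof -
      have R: "(2::real) ^ Suc k > 0"
        by simp
      have "a k \<le> J (2 ^ Suc k)"
        unfolding a_def by (rule E_le_J[OF R])
      also have "\<dots> \<le> \<delta> * (LINT x:(ball 0 (2 * 2 ^ Suc k) - ball 0 (2 ^ Suc k))|lebesgue.
          (\<zeta> (2 ^ Suc k) x)\<^sup>2 * e x) + C / \<delta>"
        unfolding J_def by (rule key[OF pow that])
      also have "\<dots> \<le> \<delta> * (a (Suc k) - a k) + C / \<delta>"
        using W_le_E[OF R] that by (simp add: a_def)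
      finally show ?thesis .
    qed
    then show "\<exists>N. \<forall>k\<ge>N. a k \<le> \<delta> * (a (Suc k) - a k) + C / \<delta>"
      by blast
  qed
  note l_le = this
  \<comment> \<open>The choice \<open>\<delta> = (C + 1) / l\<close> gives \<open>C / \<delta> < l\<close>.\<close>
  have "l \<le> 0"
  proof (rule ccontr)
    assume "\<not> l \<le> 0"
    then have "l > 0" by simp
    moreover have "C \<ge> 0"
      using l_le[of 1] \<open>l > 0\<close> by simp
    ultimately have "l \<le> C / ((C + 1) / l)"
      by (intro l_le) auto
    then show False
      using \<open>l > 0\<close> \<open>C \<ge> 0\<close> by (simp add: field_simps)
  qed
  have "AE x in lebesgue. indicator (ball 0 (2 ^ Suc k)) x *\<^sub>R e x = 0" for k
  proof -
    have int: "integrable lebesgue (\<lambda>x. indicator (ball 0 (2 ^ Suc k)) x *\<^sub>R e x)"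
      using int_E by (simp add: set_integrable_def)
    have nonneg: "AE x in lebesgue. 0 \<le> indicator (ball 0 (2 ^ Suc k)) x *\<^sub>R e x"
      using e(2) by simp
    have "(LINT x|lebesgue. indicator (ball 0 (2 ^ Suc k)) x *\<^sub>R e x) = 0"
      using le_l[of k] \<open>l \<le> 0\<close> integral_nonneg_AE[OF nonneg]
      by (simp add: a_def E_def set_lebesgue_integral_def)
    then show ?thesis
      using integral_nonneg_eq_0_iff_AE[OF int nonneg] by simp
  qed
  then have "AE x in lebesgue. \<forall>k. indicator (ball 0 (2 ^ Suc k)) x *\<^sub>R e x = 0"
    by (simp only: AE_all_countable) blast
  then show ?thesis
  proof eventually_elim
    fix x :: 'a
    assume *: "\<forall>k. indicator (ball 0 (2 ^ Suc k)) x *\<^sub>R e x = 0"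
    obtain k where k: "norm x < 2 ^ k"
      using real_arch_pow[of 2 "norm x"] by auto
    also have "\<dots> \<le> (2::real) ^ Suc k"
      by simp
    finally show "e x = 0"
      using *[rule_format, of k] by (auto simp: indicator_def)
  qed
qed

text \<open>Young's inequality in the form needed on the annulus, where \<open>p\<close>, \<open>s\<close>, \<open>z\<close> and \<open>v\<close> are the values
  of \<open>\<phi>\<^sub>i\<^sup>2\<close>, \<open>\<sigma>\<^sub>i\<close>, \<open>\<zeta>\<close> and \<open>\<nabla>\<zeta>\<close>. The factor \<open>z\<^sup>2\<close> stays with the gradient term, which can then be absorbed
  for \<open>\<delta> < 1\<close>.\<close>

lemma weighted_young:
  fixes G v :: "'a::real_inner" and p s z c \<delta> :: real
  assumes "norm v \<le> c" "\<delta> > 0" "p \<ge> 0"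
  shows "- (s * (p * (G \<bullet> ((2 * z) *\<^sub>R v)))) \<le> \<delta> * (z\<^sup>2 * (p * (G \<bullet> G))) + c\<^sup>2 / \<delta> * (p * s\<^sup>2)"
proof -
  have "- (2 * (s * z * (G \<bullet> v))) \<le> 2 * ((\<bar>z\<bar> * norm G) * (\<bar>s\<bar> * c))"
  proof -
    have "- (s * z * (G \<bullet> v)) \<le> \<bar>s * z * (G \<bullet> v)\<bar>"
      by simp
    also have "\<dots> \<le> \<bar>s * z\<bar> * (norm G * c)"
      unfolding abs_mult[of "s * z"]
      by (intro mult_left_mono order_trans[OF Cauchy_Schwarz_ineq2] assms(1)) auto
    also have "\<dots> = (\<bar>z\<bar> * norm G) * (\<bar>s\<bar> * c)"
      by (simp add: abs_mult)
    finally show ?thesis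
      by linarith
  qed
  also have "\<dots> \<le> \<delta> * (\<bar>z\<bar> * norm G)\<^sup>2 + (\<bar>s\<bar> * c)\<^sup>2 / \<delta>"
    using sum_squares_bound[of "sqrt \<delta> * (\<bar>z\<bar> * norm G)" "\<bar>s\<bar> * c / sqrt \<delta>"] assms(2)
    by (simp add: power_mult_distrib power_divide)
  also have "\<dots> = \<delta> * (z\<^sup>2 * (G \<bullet> G)) + c\<^sup>2 / \<delta> * s\<^sup>2"
    by (simp add: power_mult_distrib power2_norm_eq_inner)
  finally have "p * - (2 * (s * z * (G \<bullet> v))) \<le> p * (\<delta> * (z\<^sup>2 * (G \<bullet> G)) + c\<^sup>2 / \<delta> * s\<^sup>2)"
    using assms(3) by (rule mult_left_mono)
  then show ?thesis
    by (simp add: algebra_simps)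
qed

section \<open>The Liouville theorem\<close>

theorem proposition1:
  fixes m :: nat
    and \<phi> \<sigma> k :: "nat \<Rightarrow> real ^ 'n \<Rightarrow> real"
    and h :: "nat \<Rightarrow> nat \<Rightarrow> real ^ 'n \<Rightarrow> real"
    and f g :: "real \<Rightarrow> real"
  assumes "m \<ge> 1"
    and "\<And>i. i \<in> {1..m} \<Longrightarrow> \<phi> i \<in> Linf_loc"
    and "\<And>i. i \<in> {1..m} \<Longrightarrow> AE x in lebesgue. (\<phi> i x)\<^sup>2 > 0"
    and "\<And>i. i \<in> {1..m} \<Longrightarrow> \<sigma> i \<in> H1_loc"
    and "\<exists>C. \<forall>R>1. (\<Sum>i\<in>{1..m}. LINT x:(ball 0 (2 * R) - ball 0 R)|lebesgue.
           (\<phi> i x)\<^sup>2 * (\<sigma> i x)\<^sup>2) \<le> C * R\<^sup>2"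
    and "\<And>i j. i \<in> {1..m} \<Longrightarrow> j \<in> {1..m} \<Longrightarrow> h i j \<in> L1_loc"
    and "\<And>i. i \<in> {1..m} \<Longrightarrow> k i \<in> L1_loc"
    and "\<And>i j. i \<in> {1..m} \<Longrightarrow> j \<in> {1..m} \<Longrightarrow> AE x in lebesgue. h i j x \<le> 0"
    and "\<And>i. i \<in> {1..m} \<Longrightarrow> AE x in lebesgue. k i x \<le> 0"
    and "\<And>i j. i \<in> {1..m} \<Longrightarrow> j \<in> {1..m} \<Longrightarrow> AE x in lebesgue. h i j x = h j i x"
    and "f \<in> L1_loc" and "g \<in> L1_loc"
    and "\<And>t. f (- t) = - f t" and "\<And>t. g (- t) = - g t"
    and "\<And>t. t > 0 \<Longrightarrow> f t \<ge> 0" and "\<And>t. t > 0 \<Longrightarrow> g t \<ge> 0"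
    and "weak_solution m \<phi> h k f g \<sigma>"
  shows "\<forall>i\<in>{1..m}. \<exists>c. AE x in lebesgue. \<sigma> i x = c"
proof -
  define I where "I = {1..m}"
  have I: "finite I"
    by (simp add: I_def)
  define G where "G i = weak_grad (\<sigma> i)" for i
  define A where "A i x = (\<phi> i x)\<^sup>2 *\<^sub>R G i x" for i x
  define Z where "Z i x = (\<Sum>j\<in>I. h i j x * f (\<sigma> i x - \<sigma> j x)) + k i x * g (\<sigma> i x)" for i x
  have "G i \<in> L2_loc \<and> has_weak_gradient (\<sigma> i) (G i)" if "i \<in> I" for i
    using assms(4)[of i] that unfolding G_def weak_grad_def H1_loc_def I_def
    by (intro someI_ex[of "\<lambda>G. G \<in> L2_loc \<and> has_weak_gradient (\<sigma> i) G"]) auto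
  then have G: "\<And>i. i \<in> I \<Longrightarrow> G i \<in> L2_loc" and weak: "\<And>i. i \<in> I \<Longrightarrow> has_weak_gradient (\<sigma> i) (G i)"
    by auto
  have \<sigma>: "\<sigma> i \<in> L2_loc" if "i \<in> I" for i
    using assms(4)[of i] that by (simp add: H1_loc_def I_def)
  have \<phi>2: "(\<lambda>x. (\<phi> i x)\<^sup>2) \<in> Linf_loc" if "i \<in> I" for i
    using assms(2)[of i] that by (intro Linf_loc_sq) (simp add: I_def)
  have A: "A i \<in> L2_loc" if "i \<in> I" for i
    unfolding A_def by (rule L2_loc_Linf_loc_mult[OF G[OF that] \<phi>2[OF that]])
  have Z: "Z i \<in> L1_loc" if "i \<in> I" for i
    unfolding Z_def using assms(17) that I
    by (intro L1_loc_add L1_loc_sum) (auto simp: weak_solution_def I_def)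
  have eq: "(LINT x|lebesgue. A i x \<bullet> grad \<psi> x) = (LINT x|lebesgue. Z i x * \<psi> x)"
    if "i \<in> I" "\<psi> \<in> test_functions" for i \<psi>
    using assms(17) that unfolding weak_solution_def A_def Z_def G_def I_def by simp
  have sign: "AE x in lebesgue. (\<Sum>i\<in>I. Z i x * T (\<sigma> i x)) \<le> 0"
    if T: "mono T" "\<And>t. T (- t) = - T t" for T
  proof -
    have "AE x in lebesgue. \<forall>i\<in>I. \<forall>j\<in>I. h i j x \<le> 0"
      using assms(8) I by (intro AE_finite_allI) (auto simp: I_def)
    moreover have "AE x in lebesgue. \<forall>i\<in>I. \<forall>j\<in>I. h i j x = h j i x"
      using assms(10) I by (intro AE_finite_allI) (auto simp: I_def)
    moreover have "AE x in lebesgue. \<forall>i\<in>I. k i x \<le> 0"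
      using assms(9) I by (intro AE_finite_allI) (auto simp: I_def)
    ultimately show ?thesis
    proof eventually_elim
      fix x
      assume "\<forall>i\<in>I. \<forall>j\<in>I. h i j x \<le> 0" "\<forall>i\<in>I. \<forall>j\<in>I. h i j x = h j i x" "\<forall>i\<in>I. k i x \<le> 0"
      then show "(\<Sum>i\<in>I. Z i x * T (\<sigma> i x)) \<le> 0"
        unfolding Z_def using assms(13-16) T
        by (intro coupling_sum_nonpos[where h="\<lambda>i j. h i j x" and k="\<lambda>i. k i x"]) auto
    qed
  qed
  obtain C where C: "\<And>R. R > 1 \<Longrightarrow> (\<Sum>i\<in>I. LINT x:(ball 0 (2 * R) - ball 0 R)|lebesgue.
      (\<phi> i x)\<^sup>2 * (\<sigma> i x)\<^sup>2) \<le> C * R\<^sup>2"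
    using assms(5) unfolding I_def by blast
  obtain D :: real and \<zeta> :: "real \<Rightarrow> real ^ 'n \<Rightarrow> real"
    where test: "\<And>R. R > 0 \<Longrightarrow> \<zeta> R \<in> test_functions"
    and range: "\<And>R x. 0 \<le> \<zeta> R x \<and> \<zeta> R x \<le> 1"
    and one: "\<And>R x. R > 0 \<Longrightarrow> x \<in> ball 0 R \<Longrightarrow> \<zeta> R x = 1"
    and grad_le: "\<And>R x. R > 0 \<Longrightarrow> norm (grad (\<zeta> R) x) \<le> D / R"
    and grad_0: "\<And>R x. R > 0 \<Longrightarrow> x \<notin> ball 0 (2 * R) - ball 0 R \<Longrightarrow> grad (\<zeta> R) x = 0"
    by (rule cutoff_functions) (rule that; assumption)
  define e where "e i x = A i x \<bullet> G i x" for i x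
  define b where "b i x = (\<phi> i x)\<^sup>2 * (\<sigma> i x)\<^sup>2" for i x
  have e_eq: "e i x = (\<phi> i x)\<^sup>2 * (G i x \<bullet> G i x)" for i x
    by (simp add: e_def A_def)
  have e_L1: "e i \<in> L1_loc" if "i \<in> I" for i
    unfolding e_def by (rule L1_loc_L2_inner[OF A[OF that] G[OF that]])
  have b_L1: "b i \<in> L1_loc" if "i \<in> I" for i
    using L1_loc_L2_inner[OF L2_loc_Linf_loc_mult[OF \<sigma>[OF that] \<phi>2[OF that]] \<sigma>[OF that]]
    by (simp add: b_def[abs_def] power2_eq_square mult.assoc)
  have "AE x in lebesgue. (\<Sum>i\<in>I. e i x) = 0"
  proof (rule energy_vanishes[where \<zeta>=\<zeta> and C="D\<^sup>2 * C"])
    show "(\<lambda>x. \<Sum>i\<in>I. e i x) \<in> L1_loc"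
      by (rule L1_loc_sum[OF I e_L1])
    show "(\<Sum>i\<in>I. e i x) \<ge> 0" for x
      unfolding e_eq by (intro sum_nonneg mult_nonneg_nonneg) auto
    fix R \<delta> :: real
    assume "R > 1" and \<delta>: "\<delta> > 0"
    then have R: "R > 0" by simp
    define W where "W = ball (0 :: real ^ 'n) (2 * R) - ball 0 R"
    have W: "W \<in> sets lebesgue" "W \<subseteq> cball 0 (2 * R)"
      by (auto simp: W_def)
    define \<theta> where "\<theta> x = \<zeta> R x * \<zeta> R x" for x
    have sm: "smooth (\<zeta> R)"
      by (rule test_function_smooth[OF test[OF R]])
    have \<theta>: "\<theta> \<in> test_functions"
      unfolding \<theta>_def by (rule test_function_mult[OF test[OF R] sm])
    have grad_\<theta>: "grad \<theta> x = (2 * \<zeta> R x) *\<^sub>R grad (\<zeta> R) x" for x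
      unfolding \<theta>_def grad_mult[OF sm sm] by (simp flip: scaleR_left_distrib)
    have int1: "integrable lebesgue (\<lambda>x. \<theta> x * e i x)" if "i \<in> I" for i
      using integrable_L1_loc_times_test[OF e_L1[OF that] \<theta>] by (simp add: mult.commute)
    have int2: "integrable lebesgue (\<lambda>x. \<sigma> i x * (A i x \<bullet> grad \<theta> x))" if "i \<in> I" for i
      using integrable_L1_loc_inner_grad[OF L1_loc_L2_scaleR[OF \<sigma>[OF that] A[OF that]] \<theta>] by simp
    have int3: "set_integrable lebesgue W (\<lambda>x. \<delta> * (\<theta> x * e i x) + (D / R)\<^sup>2 / \<delta> * b i x)" if "i \<in> I" for i
    proof (intro set_integral_add set_integrable_mult_right)
      show "set_integrable lebesgue W (\<lambda>x. \<theta> x * e i x)"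
        unfolding set_integrable_def by (rule integrable_mult_indicator[OF W(1) int1[OF that]])
      show "set_integrable lebesgue W (b i)"
        by (rule L1_loc_set_integrable_subset_cball[OF b_L1[OF that] W])
    qed
    have young: "- (\<sigma> i x * (A i x \<bullet> grad \<theta> x))
        \<le> indicator W x *\<^sub>R (\<delta> * (\<theta> x * e i x) + (D / R)\<^sup>2 / \<delta> * b i x)" for i x
    proof (cases "x \<in> W")
      case True
      have A_grad: "A i x \<bullet> grad \<theta> x = (\<phi> i x)\<^sup>2 * (G i x \<bullet> ((2 * \<zeta> R x) *\<^sub>R grad (\<zeta> R) x))"
        by (simp only: A_def grad_\<theta> inner_scaleR_left)
      show ?thesis
        using weighted_young[OF grad_le[OF R, of x] \<delta>, of "(\<phi> i x)\<^sup>2" "\<sigma> i x" "G i x" "\<zeta> R x"] True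
        by (simp only: A_grad e_eq b_def \<theta>_def power2_eq_square[of "\<zeta> R x"] indicator_simps scaleR_one zero_le_power2)
    next
      case False
      then show ?thesis
        using grad_0[OF R, of x] by (simp add: grad_\<theta> W_def)
    qed
    have "(\<Sum>i\<in>I. LINT x|lebesgue. \<theta> x * (A i x \<bullet> G i x) + \<sigma> i x * (A i x \<bullet> grad \<theta> x)) \<le> 0"
      by (rule energy_inequality[OF I A Z \<sigma> G weak eq sign \<theta>]) (auto simp: \<theta>_def)
    then have "(\<Sum>i\<in>I. LINT x|lebesgue. \<theta> x * e i x) \<le> (\<Sum>i\<in>I. LINT x|lebesgue. - (\<sigma> i x * (A i x \<bullet> grad \<theta> x)))"
      using int1 int2 by (simp add: e_def sum.distrib sum_negf)
    also have "\<dots> \<le> (\<Sum>i\<in>I. LINT x:W|lebesgue. \<delta> * (\<theta> x * e i x) + (D / R)\<^sup>2 / \<delta> * b i x)"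
      unfolding set_lebesgue_integral_def
      by (intro sum_mono Bochner_Integration.integral_mono young integrable_minus int2)
        (use int3 in \<open>auto simp: set_integrable_def\<close>)
    also have "\<dots> = (\<Sum>i\<in>I. \<delta> * (LINT x:W|lebesgue. \<theta> x * e i x) + (D / R)\<^sup>2 / \<delta> * (LINT x:W|lebesgue. b i x))"
    proof (rule sum.cong[OF refl])
      fix i
      assume i: "i \<in> I"
      have "set_integrable lebesgue W (\<lambda>x. \<theta> x * e i x)" "set_integrable lebesgue W (b i)"
        using integrable_mult_indicator[OF W(1) int1[OF i]]
          L1_loc_set_integrable_subset_cball[OF b_L1[OF i] W]
        by (auto simp: set_integrable_def)
      then show "(LINT x:W|lebesgue. \<delta> * (\<theta> x * e i x) + (D / R)\<^sup>2 / \<delta> * b i x)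
          = \<delta> * (LINT x:W|lebesgue. \<theta> x * e i x) + (D / R)\<^sup>2 / \<delta> * (LINT x:W|lebesgue. b i x)"
        by (subst set_integral_add(2)) auto
    qed
    also have "\<dots> = \<delta> * (\<Sum>i\<in>I. LINT x:W|lebesgue. \<theta> x * e i x)
        + (D / R)\<^sup>2 / \<delta> * (\<Sum>i\<in>I. LINT x:W|lebesgue. b i x)"
      by (simp add: sum.distrib sum_distrib_left)
    also have "\<dots> \<le> \<delta> * (\<Sum>i\<in>I. LINT x:W|lebesgue. \<theta> x * e i x) + (D / R)\<^sup>2 / \<delta> * (C * R\<^sup>2)"
      using C[OF \<open>R > 1\<close>] \<delta> by (intro add_left_mono mult_left_mono) (auto simp: W_def b_def)
    also have "(D / R)\<^sup>2 / \<delta> * (C * R\<^sup>2) = D\<^sup>2 * C / \<delta>"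
      using R by (simp add: power_divide)
    finally have main: "(\<Sum>i\<in>I. LINT x|lebesgue. \<theta> x * e i x)
        \<le> \<delta> * (\<Sum>i\<in>I. LINT x:W|lebesgue. \<theta> x * e i x) + D\<^sup>2 * C / \<delta>" .
    have s1: "(\<Sum>i\<in>I. LINT x|lebesgue. \<theta> x * e i x) = (LINT x|lebesgue. (\<zeta> R x)\<^sup>2 * (\<Sum>i\<in>I. e i x))"
    proof -
      have "(\<Sum>i\<in>I. LINT x|lebesgue. \<theta> x * e i x) = (LINT x|lebesgue. (\<Sum>i\<in>I. \<theta> x * e i x))"
        by (rule Bochner_Integration.integral_sum[symmetric]) (rule int1)
      then show ?thesis
        by (simp add: \<theta>_def power2_eq_square sum_distrib_left)
    qed
    have s2: "(\<Sum>i\<in>I. LINT x:W|lebesgue. \<theta> x * e i x) = (LINT x:W|lebesgue. (\<zeta> R x)\<^sup>2 * (\<Sum>i\<in>I. e i x))"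
    proof -
      have "(\<Sum>i\<in>I. LINT x:W|lebesgue. \<theta> x * e i x) = (LINT x|lebesgue. (\<Sum>i\<in>I. indicator W x *\<^sub>R (\<theta> x * e i x)))"
        unfolding set_lebesgue_integral_def
        by (rule Bochner_Integration.integral_sum[symmetric]) (rule integrable_mult_indicator[OF W(1) int1])
      also have "\<dots> = (LINT x:W|lebesgue. \<Sum>i\<in>I. \<theta> x * e i x)"
        by (simp only: set_lebesgue_integral_def scaleR_sum_right)
      finally show ?thesis
        by (simp add: \<theta>_def power2_eq_square sum_distrib_left)
    qed
    show "(LINT x|lebesgue. (\<zeta> R x)\<^sup>2 * (\<Sum>i\<in>I. e i x))
        \<le> \<delta> * (LINT x:(ball 0 (2 * R) - ball 0 R)|lebesgue. (\<zeta> R x)\<^sup>2 * (\<Sum>i\<in>I. e i x)) + D\<^sup>2 * C / \<delta>"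
      using main unfolding s1 s2 unfolding W_def .
  qed (use test range one in auto)
  then have grad_zero: "AE x in lebesgue. G i x = 0" if i: "i \<in> I" for i
    using assms(3)[OF i[unfolded I_def]]
  proof eventually_elim
    fix x
    assume sum_0: "(\<Sum>i\<in>I. e i x) = 0" and pos: "(\<phi> i x)\<^sup>2 > 0"
    have "e j x \<ge> 0" for j
      by (simp add: e_eq)
    then have "e i x = 0"
      using sum_0 sum_nonneg_eq_0_iff[OF I, of "\<lambda>i. e i x"] i by blast
    then show "G i x = 0"
      using pos by (simp add: e_eq)
  qed
  show ?thesis
    using weak_gradient_zero_imp_const[OF \<sigma> G weak grad_zero] by (simp add: I_def)
qed

end
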